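(* Let $n\geq 1$ be an integer. There exists a polyhedral $n$-dimensional real Banach space $(F_n,\|\cdot\|)$ such that $$\Pi(F_n)=\Pi_n.$$ As a result, there is an integer $D\geq 1$ such that $\Pi(n,d)=\Pi(n,D)$ for all integers $d\geq D$.
   Context: For a finite-dimensional real Banach space $E$, fix a linear isometric embedding $E\subset \ell_\infty(\mathbb{N})$; the linear projection constant of $E$ is $\Pi(E):=\inf\{\|P\| : P\colon \ell_\infty(\mathbb{N})\to E \text{ bounded surjective linear map with } P^2=P\}$ (independent of the embedding). Set $\Pi_n:=\max\{\Pi(X) : X \text{ an } n\text{-dimensional real Banach space}\}$ (this maximum exists). For integers $n,d\geq 0$ set $\Pi(n,d):=\sup\{\Pi(E) : E\subset \ell_\infty^d \text{ is an } n\text{-dimensional linear subspace}\}$, where $\ell_\infty^d$ is $\mathbb{R}^d$ with the maximum norm, $E$ carries the induced norm, and $\sup\varnothing=-\infty$. A finite-dimensional Banach space is polyhedral if its unit ball is a polytope; equivalently, if it admits a linear isometric embedding into $\ell_\infty^d$ for some integer $d\geq 1$. *)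

theory Defs
  imports "HOL-Analysis.Analysis"
begin

text \<open>The topology of \<^typ>\<open>nat\<close> is discrete, so bounded continuous functions on it with the
  supremum norm are exactly the bounded real sequences.\<close>

type_synonym linf = "nat \<Rightarrow>\<^sub>C real"

text \<open>A finite-dimensional real Banach space is a pair \<open>(V, N)\<close>: a finite-dimensional linear
  subspace \<open>V\<close> of a real vector space, which only supplies the vectors, and an arbitrary norm \<open>N\<close>
  on \<open>V\<close>. Completeness is automatic. Only the values of \<open>N\<close> on \<open>V\<close> matter.\<close>

definition norm_on :: "'a::real_vector set \<Rightarrow> ('a \<Rightarrow> real) \<Rightarrow> bool" where
  "norm_on V N \<longleftrightarrow>
     (\<forall>x\<in>V. 0 \<le> N x) \<and>
     (\<forall>x\<in>V. N x = 0 \<longleftrightarrow> x = 0) \<and>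
     (\<forall>x\<in>V. \<forall>c. N (c *\<^sub>R x) = \<bar>c\<bar> * N x) \<and>
     (\<forall>x\<in>V. \<forall>y\<in>V. N (x + y) \<le> N x + N y)"

text \<open>The finite spanning set is needed because \<^const>\<open>dim\<close> is \<open>0\<close> on infinite-dimensional
  subspaces.\<close>

definition subspace_of_dim :: "nat \<Rightarrow> 'a::real_vector set \<Rightarrow> bool" where
  "subspace_of_dim n V \<longleftrightarrow> subspace V \<and> (\<exists>B. finite B \<and> span B = V) \<and> dim V = n"

definition banach_of_dim :: "nat \<Rightarrow> 'a::real_vector set \<Rightarrow> ('a \<Rightarrow> real) \<Rightarrow> bool" where
  "banach_of_dim n V N \<longleftrightarrow> subspace_of_dim n V \<and> norm_on V N"

definition polyhedral :: "'a::real_vector set \<Rightarrow> ('a \<Rightarrow> real) \<Rightarrow> bool" where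
  "polyhedral V N \<longleftrightarrow> polytope {x \<in> V. N x \<le> 1}"

text \<open>Asking the embedding to be linear on the whole ambient space is no restriction, since a linear
  map on \<open>V\<close> always extends linearly; only its restriction to \<open>V\<close> is used.\<close>

definition isometric_embedding ::
  "'a::real_vector set \<Rightarrow> ('a \<Rightarrow> real) \<Rightarrow> ('a \<Rightarrow> linf) \<Rightarrow> bool" where
  "isometric_embedding V N T \<longleftrightarrow> linear T \<and> (\<forall>x\<in>V. norm (T x) = N x)"

definition projection_onto :: "linf set \<Rightarrow> (linf \<Rightarrow> linf) \<Rightarrow> bool" where
  "projection_onto E P \<longleftrightarrow> bounded_linear P \<and> range P = E \<and> P \<circ> P = P"

definition embedded_proj_const :: "linf set \<Rightarrow> ereal" where
  "embedded_proj_const E = (INF P \<in> {P. projection_onto E P}. ereal (onorm P))"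

text \<open>The linear projection constant, computed in one fixed linear isometric embedding into
  \<^typ>\<open>linf\<close>; for finite-dimensional spaces an embedding exists and the value is independent of
  its choice.\<close>

definition proj_const :: "'a::real_vector set \<Rightarrow> ('a \<Rightarrow> real) \<Rightarrow> ereal" where
  "proj_const V N = embedded_proj_const ((SOME T. isometric_embedding V N T) ` V)"

text \<open>The maximal projection constant. The vectors are taken from \<^typ>\<open>linf\<close>, but the norms \<open>N\<close>
  are arbitrary, so that every \<open>n\<close>-dimensional Banach space occurs up to linear isometry; see
  \<open>banach_of_dim_linf\<close> below.\<close>

definition max_proj_const :: "nat \<Rightarrow> ereal" where
  "max_proj_const n =
     Sup {proj_const V N | (V :: linf set) N. banach_of_dim n V N}"

text \<open>The space \<open>\<real>\<^sup>d\<close> with the maximum norm, as the sequences supported in \<open>{..<d}\<close>; see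
  \<open>norm_linf_d\<close> below.\<close>

definition linf_d :: "nat \<Rightarrow> linf set" where
  "linf_d d = {x. \<forall>i\<ge>d. apply_bcontfun x i = 0}"

text \<open>In \<^typ>\<open>ereal\<close> the supremum of the empty set is \<open>-\<infinity>\<close>.\<close>

definition max_proj_const_in :: "nat \<Rightarrow> nat \<Rightarrow> ereal" where
  "max_proj_const_in n d =
     Sup {proj_const E norm | E. subspace_of_dim n E \<and> E \<subseteq> linf_d d}"

lemma norm_linf_d:
  assumes "x \<in> linf_d d" "d \<ge> 1"
  shows "norm x = Max ((\<lambda>i. \<bar>apply_bcontfun x i\<bar>) ` {..<d})"
proof (rule antisym)
  let ?M = "Max ((\<lambda>i. \<bar>apply_bcontfun x i\<bar>) ` {..<d})"
  have le: "\<bar>apply_bcontfun x i\<bar> \<le> ?M" if "i < d" for i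
    using that by (intro Max_ge) auto
  have "0 \<le> ?M"
    using order_trans[OF abs_ge_zero le[of 0]] assms(2) by linarith
  then have "norm (apply_bcontfun x i) \<le> ?M" for i
    using le[of i] assms(1) by (cases "i < d") (auto simp: linf_d_def)
  then show "norm x \<le> ?M"
    by (rule norm_bound)
  show "?M \<le> norm x"
    using assms(2) norm_bounded[of x] by (subst Max_le_iff) (auto simp: lessThan_empty_iff)
qed

lemma linf_d_coordinates:
  "bij_betw (\<lambda>x. restrict (apply_bcontfun x) {..<d}) (linf_d d) ({..<d} \<rightarrow>\<^sub>E UNIV)"
proof (rule bij_betwI')
  fix x y assume "x \<in> linf_d d" "y \<in> linf_d d"
  then show "(restrict (apply_bcontfun x) {..<d} = restrict (apply_bcontfun y) {..<d}) = (x = y)"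
    by (auto simp: linf_d_def restrict_def fun_eq_iff intro!: bcontfun_eqI) (metis not_less)
next
  fix y :: "nat \<Rightarrow> real" assume y: "y \<in> {..<d} \<rightarrow>\<^sub>E UNIV"
  let ?f = "\<lambda>i. if i < d then y i else 0"
  have "range ?f \<subseteq> insert 0 (y ` {..<d})" by auto
  then have "bounded (range ?f)"
    by (meson bounded_subset finite_imageI finite_imp_bounded finite_insert finite_lessThan)
  then have "?f \<in> bcontfun" by (simp add: bcontfun_def continuous_on_discrete)
  then have f: "apply_bcontfun (Bcontfun ?f) = ?f" by (rule Bcontfun_inverse)
  show "\<exists>x\<in>linf_d d. y = restrict (apply_bcontfun x) {..<d}"
    by (rule bexI[of _ "Bcontfun ?f"])
      (use y in \<open>auto simp: f linf_d_def fun_eq_iff PiE_def extensional_def\<close>)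
qed auto

lemma banach_of_dim_linf:
  fixes V :: "'a::real_vector set"
  assumes "banach_of_dim n V N"
  obtains T :: "'a \<Rightarrow> linf" and N' where
    "linear T" "inj_on T V" "banach_of_dim n (T ` V) N'" "\<And>x. x \<in> V \<Longrightarrow> N' (T x) = N x"
proof -
  define e :: "nat \<Rightarrow> linf" where "e k = Bcontfun (\<lambda>i. if i = k then 1 else 0)" for k
  have e: "apply_bcontfun (e k) i = (if i = k then 1 else 0)" for i k
  proof -
    have "bounded (range (\<lambda>i. if i = k then 1 else (0::real)))"
      by (rule bounded_subset[of "{0, 1}"]) auto
    then have "(\<lambda>i. if i = k then 1 else (0::real)) \<in> bcontfun"
      by (simp add: bcontfun_def continuous_on_discrete)
    then show ?thesis by (simp add: e_def Bcontfun_inverse)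
  qed
  have inj_e: "inj e"
    by (rule injI) (metis e zero_neq_one)
  have sum_app: "apply_bcontfun (\<Sum>k\<in>K. c k *\<^sub>R e k) i = (\<Sum>k\<in>K. c k * apply_bcontfun (e k) i)"
    if "finite K" for K c i
    using that by induction auto
  have indep_e: "independent (e ` K)" if K: "finite K" for K
  proof (rule independent_if_scalars_zero)
    fix c x assume c: "(\<Sum>x\<in>e ` K. c x *\<^sub>R x) = 0" and "x \<in> e ` K"
    then obtain i where i: "i \<in> K" "x = e i" by auto
    have "0 = apply_bcontfun (\<Sum>k\<in>K. c (e k) *\<^sub>R e k) i"
      using c by (simp add: sum.reindex inj_on_subset[OF inj_e])
    also have "\<dots> = c (e i)"
      using i K by (simp add: sum_app e mult_delta_right)
    finally show "c x = 0" using i by simp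
  qed (use K in simp)
  from assms have V: "subspace V" "dim V = n" and N: "norm_on V N"
    by (auto simp: banach_of_dim_def subspace_of_dim_def)
  from assms obtain B0 where B0: "finite B0" "span B0 = V"
    by (auto simp: banach_of_dim_def subspace_of_dim_def)
  obtain B where B: "B \<subseteq> B0" "independent B" "B0 \<subseteq> span B"
    by (rule maximal_independent_subset)
  have fin: "finite B" using B B0 finite_subset by blast
  have spanB: "span B = V"
    using B B0 by (metis span_mono span_span subset_antisym)
  obtain h :: "'a \<Rightarrow> nat" where h: "inj_on h B"
    using finite_imp_inj_to_nat_seg[OF fin] by blast
  obtain T where T: "linear T" "\<forall>x\<in>B. T x = e (h x)"
    using linear_independent_extend[OF B(2), of "\<lambda>x. e (h x)"] by blast
  have TB: "T ` B = e ` h ` B" using T by (auto simp: image_image)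
  have "inj_on T B"
    using T h inj_e by (auto simp: inj_on_def)
  then have inj: "inj_on T V"
    using linear_inj_on_span_independent_image[OF T(1), of B] indep_e[of "h ` B"] fin TB spanB
    by simp
  define N' where "N' y = N (inv_into V T y)" for y
  have N': "N' (T x) = N x" if "x \<in> V" for x
    using that inj by (simp add: N'_def)
  have "norm_on (T ` V) N'"
    unfolding norm_on_def
  proof (intro conjI ballI allI; elim imageE; hypsubst)
    fix x assume x: "x \<in> V"
    show "0 \<le> N' (T x)" using N x by (simp add: N' norm_on_def)
    have "T x = 0 \<longleftrightarrow> x = 0"
      using inj x V(1) linear_0[OF T(1)] by (metis inj_onD subspace_0)
    then show "N' (T x) = 0 \<longleftrightarrow> T x = 0" using N x by (simp add: N' norm_on_def)
    show "N' (c *\<^sub>R T x) = \<bar>c\<bar> * N' (T x)" for c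
      using N x N'[of "c *\<^sub>R x"] V(1)
      by (simp add: N' norm_on_def linear_scale[OF T(1)] subspace_scale)
    fix y assume y: "y \<in> V"
    show "N' (T x + T y) \<le> N' (T x) + N' (T y)"
      using N x y N'[of "x + y"] V(1)
      by (simp add: N' norm_on_def linear_add[OF T(1)] subspace_add)
  qed
  moreover have "subspace_of_dim n (T ` V)"
    unfolding subspace_of_dim_def
  proof (intro conjI exI)
    show "subspace (T ` V)" by (rule linear_subspace_image[OF T(1) V(1)])
    show "finite (T ` B)" using fin by simp
    show "span (T ` B) = T ` V"
      using linear_span_image[OF T(1), of B] spanB by simp
    have "card (T ` B) = card B"
      using inj spanB by (metis card_image inj_on_subset span_superset)
    moreover have "dim (T ` V) = card (T ` B)"
      using indep_e[of "h ` B"] fin TB \<open>span (T ` B) = T ` V\<close>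
      by (metis dim_eq_card_independent dim_span finite_imageI)
    moreover have "dim V = card B"
      using B(2) spanB by (metis dim_eq_card_independent dim_span)
    ultimately show "dim (T ` V) = n" using V(2) by simp
  qed
  ultimately have "banach_of_dim n (T ` V) N'" by (simp add: banach_of_dim_def)
  with that T(1) inj N' show ?thesis by blast
qed

end

theory Submission
  imports Defs
begin

text \<open>
  Give vectors \<open>y\<^sub>l\<close> of \<open>\<real>\<^sup>n\<close> weights \<open>w\<^sub>l \<ge> 0\<close> and call
  \<open>\<Sum>\<^sub>l\<^sub>k w\<^sub>l w\<^sub>k \<bar>\<langle>y\<^sub>l, y\<^sub>k\<rangle>\<bar>\<close> the energy of the finite family. The maximal projection constant turns
  out to be the maximal energy \<open>M\<close> among families that have total mass \<open>1\<close> and whose second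
  moments \<open>\<Sum>\<^sub>l w\<^sub>l y\<^sub>l(a) y\<^sub>l(b)\<close> form the identity matrix.

  \<^emph>\<open>Small projections.\<close> Let \<open>E\<close> be an \<open>n\<close>-dimensional space of bounded sequences. A projection
  onto \<open>E\<close> of norm at most \<open>M\<close> amounts to a linear functional on finite families \<open>(a\<^sub>j)\<close> of bounded
  sequences, dominated by \<open>M \<Sum>\<^sub>j \<parallel>a\<^sub>j\<parallel>\<close>, and by the Hahn--Banach theorem it exists as soon as the trace of every operator
  \<open>v z = \<Sum>\<^sub>j z\<^sub>j a\<^sub>j\<close> that maps \<open>E\<close> into itself is at most \<open>M \<Sum>\<^sub>j \<parallel>a\<^sub>j\<parallel>\<close>
  (\<open>projection_from_energy_bound\<close>). Computed in a basis of \<open>E\<close> that is orthonormal for the form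
  \<open>\<Sum>\<^sub>j \<parallel>a\<^sub>j\<parallel> x\<^sub>j z\<^sub>j\<close>, this trace is bounded by the energy of a family with weights \<open>\<parallel>a\<^sub>j\<parallel>\<close>
  (\<open>trace_bound\<close>).

  \<^emph>\<open>Finitely many points suffice.\<close> Cut \<open>\<real>\<^sup>n\<close> into finitely many cones in each of which inner
  products are nonnegative. Inside one cone \<open>\<bar>\<langle>y, z\<rangle>\<bar> = \<langle>y, z\<rangle>\<close>, a positive semidefinite kernel, so the
  energy is a convex function of the weights of the points in that cone. If there are more of them
  than the mass and the second moments impose linear constraints, the weights can be moved along a
  line that respects the constraints, in the direction in which the energy does not drop, until one
  of them vanishes (\<open>weight_reduction\<close>). Hence the energy only needs to be maximised over families
  of \<open>D\<close> points, with \<open>D\<close> depending on \<open>n\<close> alone, and by compactness the maximum is attained.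

  \<^emph>\<open>Large projections.\<close> Put \<open>s\<^sub>l = \<surd>w\<^sub>l\<close> and \<open>g\<^sub>l = s\<^sub>l y\<^sub>l\<close>, so that the columns of \<open>g\<close> are
  orthonormal. When the energy is maximal, rotating a column of \<open>g\<close> cannot increase it, and the
  first-order condition says that the column space of \<open>g\<close> is invariant under the symmetric matrix
  \<open>s\<^sub>l sgn\<langle>g\<^sub>l, g\<^sub>k\<rangle> s\<^sub>k\<close>, with trace \<open>M\<close> (\<open>maximal_frame_invariant\<close>). The columns of \<open>y\<close> then span
  a subspace \<open>F\<close> of \<open>\<real>\<^sup>D\<close> with the maximum norm that is invariant under \<open>sgn\<langle>y\<^sub>l, y\<^sub>k\<rangle> w\<^sub>k\<close>.
  Pairing that matrix with a projection onto \<open>F\<close> gives \<open>M\<close> on one side and at most the norm of the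
  projection on the other (\<open>trace_duality\<close>).

  So \<open>F\<close> has projection constant \<open>M\<close>, no \<open>n\<close>-dimensional space has a larger one, the unit ball of
  \<open>F\<close> is a polytope because finitely many coordinates determine the norm, and \<open>F\<close> is contained in
  \<open>linf_d d\<close> for every \<open>d \<ge> D\<close>.
\<close>

section \<open>The Hahn--Banach theorem\<close>

definition linear_on_subspace :: "'a::real_vector set \<Rightarrow> ('a \<Rightarrow> real) \<Rightarrow> bool" where
  "linear_on_subspace W f \<longleftrightarrow>
     (\<forall>x\<in>W. \<forall>y\<in>W. f (x + y) = f x + f y) \<and> (\<forall>x\<in>W. \<forall>c. f (c *\<^sub>R x) = c * f x)"

lemma linear_imp_linear_on_subspace: "linear f \<Longrightarrow> linear_on_subspace W f"
  by (simp add: linear_on_subspace_def linear_add linear_scale)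

text \<open>  The one-dimensional extension step, phrased for the graph \<open>G\<close> of a dominated functional so that
  Zorn's lemma can later be applied to sets. The admissible values \<open>r\<close> at \<open>x\<close> lie between
  \<open>s - p (y - x)\<close> and \<open>p (y' + x) - s'\<close>, and subadditivity says that every such lower bound is below
  every such upper bound.\<close>

lemma dominated_graph_extension:
  fixes p :: "'a::real_vector \<Rightarrow> real"
  assumes sub: "\<And>x y. x \<in> W \<Longrightarrow> y \<in> W \<Longrightarrow> p (x + y) \<le> p x + p y"
    and hom: "\<And>x c. x \<in> W \<Longrightarrow> 0 \<le> c \<Longrightarrow> p (c *\<^sub>R x) = c * p x"
    and W: "subspace W" and G: "subspace G" "\<And>y s. (y, s) \<in> G \<Longrightarrow> y \<in> W \<and> s \<le> p y" and x: "x \<in> W"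
  obtains r where "\<And>y s t. (y, s) \<in> G \<Longrightarrow> s + t * r \<le> p (y + t *\<^sub>R x)"
proof -
  have cross: "s - p (y - x) \<le> p (y' + x) - s'" if "(y, s) \<in> G" "(y', s') \<in> G" for y s y' s'
  proof -
    have "(y + y', s + s') \<in> G" using subspace_add[OF G(1) that] by simp
    then have "s + s' \<le> p ((y - x) + (y' + x))" using G(2) by simp
    also have "\<dots> \<le> p (y - x) + p (y' + x)"
      using that G(2) x W by (intro sub) (auto intro: subspace_diff subspace_add)
    finally show ?thesis by linarith
  qed
  define R where "R = {s - p (y - x) |y s. (y, s) \<in> G}"
  define r where "r = Sup R"
  have zero: "(0, 0) \<in> G" using subspace_0[OF G(1)] by (simp add: zero_prod_def)
  have R: "R \<noteq> {}" "bdd_above R"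
    using zero cross[OF _ zero] by (auto simp: R_def bdd_above_def)
  have lo: "s - p (y - x) \<le> r" if "(y, s) \<in> G" for y s
    unfolding r_def by (rule cSup_upper) (use R that in \<open>auto simp: R_def\<close>)
  have hi: "r \<le> p (y + x) - s" if "(y, s) \<in> G" for y s
    unfolding r_def by (rule cSup_least) (use R cross that in \<open>auto simp: R_def\<close>)
  have "s + t * r \<le> p (y + t *\<^sub>R x)" if ys: "(y, s) \<in> G" for y s t
  proof -
    have scaled: "((1 / u) *\<^sub>R y, s / u) \<in> G" for u
      using subspace_scale[OF G(1) ys, of "1 / u"] by simp
    have yW: "y \<in> W" using G(2) ys by blast
    consider "t = 0" | "t > 0" | "t < 0" by linarith
    then show ?thesis
    proof cases
      case 1 then show ?thesis using G(2)[OF ys] by simp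
    next
      case 2
      have "t * (s / t + r) \<le> t * p ((1 / t) *\<^sub>R y + x)"
        by (rule mult_left_mono) (use hi[OF scaled, of t] 2 in auto)
      also have "\<dots> = p (t *\<^sub>R ((1 / t) *\<^sub>R y + x))"
        using 2 x yW W by (subst hom) (auto intro: subspace_add subspace_scale)
      finally show ?thesis using 2 by (simp add: algebra_simps)
    next
      case 3
      define u where "u = - t"
      have u: "u > 0" "t = - u" using 3 by (auto simp: u_def)
      have "u * (s / u - r) \<le> u * p ((1 / u) *\<^sub>R y - x)"
        by (rule mult_left_mono) (use lo[OF scaled, of u] u in auto)
      also have "\<dots> = p (u *\<^sub>R ((1 / u) *\<^sub>R y - x))"
        using u x yW W by (subst hom) (auto intro: subspace_diff subspace_scale)
      finally show ?thesis using u by (simp add: algebra_simps)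
    qed
  qed
  with that show thesis by blast
qed

text \<open>  The statement is relative to a subspace \<open>W\<close> because the gauge used to construct projections is a sum
  of norms over the support of a sequence, which is sublinear on finitely supported sequences only.\<close>

theorem hahn_banach:
  fixes p :: "'a::real_vector \<Rightarrow> real"
  assumes W: "subspace W" and S: "subspace S" "S \<subseteq> W"
    and sub: "\<And>x y. x \<in> W \<Longrightarrow> y \<in> W \<Longrightarrow> p (x + y) \<le> p x + p y"
    and hom: "\<And>x c. x \<in> W \<Longrightarrow> 0 \<le> c \<Longrightarrow> p (c *\<^sub>R x) = c * p x"
    and f: "linear_on_subspace S f" "\<And>x. x \<in> S \<Longrightarrow> f x \<le> p x"
  obtains g where "linear_on_subspace W g" "\<And>x. x \<in> S \<Longrightarrow> g x = f x" "\<And>x. x \<in> W \<Longrightarrow> g x \<le> p x"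
proof -
  define \<A> where "\<A> = {G. subspace G \<and> (\<lambda>x. (x, f x)) ` S \<subseteq> G \<and> (\<forall>y s. (y, s) \<in> G \<longrightarrow> y \<in> W \<and> s \<le> p y)}"
  have f0: "f 0 = 0" using f(1) subspace_0[OF S(1)] unfolding linear_on_subspace_def
    by (metis mult_zero_left scaleR_zero_left)
  have "subspace ((\<lambda>x. (x, f x)) ` S)"
    using f(1) S(1) f0 unfolding linear_on_subspace_def subspace_def by (auto simp: zero_prod_def)
  then have "(\<lambda>x. (x, f x)) ` S \<in> \<A>" using f(2) S(2) by (auto simp: \<A>_def)
  then have ne: "\<A> \<noteq> {}" by blast
  have "\<exists>M\<in>\<A>. \<forall>X\<in>\<A>. M \<subseteq> X \<longrightarrow> X = M"
  proof (rule subset_Zorn_nonempty[OF ne])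
    fix \<C> assume \<C>: "\<C> \<noteq> {}" "subset.chain \<A> \<C>"
    have sub_A: "X \<in> \<A>" if "X \<in> \<C>" for X using \<C>(2) that by (auto simp: subset_chain_def)
    have tot: "X \<subseteq> Y \<or> Y \<subseteq> X" if "X \<in> \<C>" "Y \<in> \<C>" for X Y
      using \<C>(2) that by (auto simp: subset_chain_def)
    have "subspace (\<Union>\<C>)"
      unfolding subspace_def
    proof (intro conjI ballI allI)
      show "0 \<in> \<Union>\<C>" using \<C>(1) sub_A subspace_0 unfolding \<A>_def by blast
      show "c *\<^sub>R x \<in> \<Union>\<C>" if "x \<in> \<Union>\<C>" for c x
        using that sub_A subspace_scale unfolding \<A>_def by blast
      fix x y assume "x \<in> \<Union>\<C>" "y \<in> \<Union>\<C>"
      then obtain X Y where XY: "X \<in> \<C>" "Y \<in> \<C>" "x \<in> X" "y \<in> Y" by blast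
      then obtain Z where "Z \<in> \<C>" "x \<in> Z" "y \<in> Z" using tot[OF XY(1,2)] by blast
      then show "x + y \<in> \<Union>\<C>" using sub_A[of Z] by (auto simp: \<A>_def intro: subspace_add)
    qed
    then show "\<Union>\<C> \<in> \<A>" using sub_A \<C>(1) unfolding \<A>_def by blast
  qed
  then obtain G where G: "G \<in> \<A>" and max: "\<And>X. X \<in> \<A> \<Longrightarrow> G \<subseteq> X \<Longrightarrow> X = G" by blast
  from G have Gsub: "subspace G" and Gf: "\<And>x. x \<in> S \<Longrightarrow> (x, f x) \<in> G"
    and Gp: "\<And>y s. (y, s) \<in> G \<Longrightarrow> y \<in> W \<and> s \<le> p y" by (auto simp: \<A>_def)
  \<comment> \<open>a maximal graph is defined on all of \<open>W\<close>, since otherwise it extends by one dimension\<close>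
  have total: "\<exists>r. (x, r) \<in> G" if x: "x \<in> W" for x
  proof -
    obtain r where r: "\<And>y s t. (y, s) \<in> G \<Longrightarrow> s + t * r \<le> p (y + t *\<^sub>R x)"
      using dominated_graph_extension[OF sub hom W Gsub Gp x] by blast
    define G' where "G' = {(y + t *\<^sub>R x, s + t * r) |y s t. (y, s) \<in> G}"
    have G'I: "(y + t *\<^sub>R x, s + t * r) \<in> G'" if "(y, s) \<in> G" for y s t
      using that unfolding G'_def by blast
    have "subspace G'"
      unfolding subspace_def
    proof (intro conjI ballI allI)
      show "0 \<in> G'" using G'I[of 0 0 0] subspace_0[OF Gsub] by (simp add: zero_prod_def)
    next
      fix u v assume "u \<in> G'" "v \<in> G'"
      then obtain y s t y' s' t' where
        1: "(y, s) \<in> G" "(y', s') \<in> G" "u = (y + t *\<^sub>R x, s + t * r)" "v = (y' + t' *\<^sub>R x, s' + t' * r)"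
        unfolding G'_def by blast
      have "(y + y', s + s') \<in> G" using subspace_add[OF Gsub 1(1,2)] by simp
      from G'I[OF this, of "t + t'"] show "u + v \<in> G'" by (simp add: 1 algebra_simps)
    next
      fix u c assume "u \<in> G'"
      then obtain y s t where 1: "(y, s) \<in> G" "u = (y + t *\<^sub>R x, s + t * r)"
        unfolding G'_def by blast
      have "(c *\<^sub>R y, c * s) \<in> G" using subspace_scale[OF Gsub 1(1), of c] by simp
      from G'I[OF this, of "c * t"] show "c *\<^sub>R u \<in> G'" by (simp add: 1 algebra_simps)
    qed
    moreover have GG': "G \<subseteq> G'" using G'I[of _ _ 0] by auto
    moreover have "y \<in> W \<and> s \<le> p y" if "(y, s) \<in> G'" for y s
      using that r Gp x W by (auto simp: G'_def intro!: subspace_add subspace_scale)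
    ultimately have "G' \<in> \<A>" using Gf unfolding \<A>_def by blast
    then have "G' = G" using max GG' by blast
    moreover have "(0, 0) \<in> G" using subspace_0[OF Gsub] by (simp add: zero_prod_def)
    ultimately have "(x, r) \<in> G" using G'I[of 0 0 1] by simp
    then show ?thesis by blast
  qed
  \<comment> \<open>a subspace dominated by \<open>p\<close> is single-valued: multiples of \<open>(0, r - s)\<close> stay below \<open>p 0 = 0\<close>\<close>
  have uniq: "r = s" if "(x, r) \<in> G" "(x, s) \<in> G" for x r s
  proof -
    have d: "(0, r - s) \<in> G" using subspace_diff[OF Gsub that] by simp
    have "p 0 = 0" using hom[of 0 0] subspace_0[OF W] by simp
    then have "c * (r - s) \<le> 0" for c
      using Gp subspace_scale[OF Gsub d, of c] by fastforce
    from this[of 1] this[of "-1"] show ?thesis by simp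
  qed
  define g where "g x = (THE r. (x, r) \<in> G)" for x
  have g: "(x, g x) \<in> G" if "x \<in> W" for x
    unfolding g_def using total[OF that] uniq by (metis the_equality)
  show thesis
  proof (rule that[of g])
    show "linear_on_subspace W g"
      unfolding linear_on_subspace_def
    proof (intro conjI ballI allI)
      fix x y assume xy: "x \<in> W" "y \<in> W"
      have "(x + y, g x + g y) \<in> G" using subspace_add[OF Gsub g[OF xy(1)] g[OF xy(2)]] by simp
      then show "g (x + y) = g x + g y" using uniq g subspace_add[OF W xy] by blast
    next
      fix x c assume x: "x \<in> W"
      have "(c *\<^sub>R x, c * g x) \<in> G" using subspace_scale[OF Gsub g[OF x], of c] by simp
      then show "g (c *\<^sub>R x) = c * g x" using uniq g subspace_scale[OF W x] by blast
    qed
    show "g x = f x" if "x \<in> S" for x using that S uniq g Gf by blast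
    show "g x \<le> p x" if "x \<in> W" for x using g[OF that] Gp by blast
  qed
qed

section \<open>The energy of a weighted family of vectors\<close>

text \<open>  Gaussian elimination: an equation with a nonzero coefficient is used to remove one unknown from
  all other equations.\<close>

lemma homogeneous_system_nontrivial_solution:
  fixes f :: "'k \<Rightarrow> 'i \<Rightarrow> real"
  assumes "finite K" "finite I" "card K < card I"
  shows "\<exists>\<tau>. (\<exists>i\<in>I. \<tau> i \<noteq> 0) \<and> (\<forall>k\<in>K. (\<Sum>i\<in>I. \<tau> i * f k i) = 0)"
  using assms
proof (induction K arbitrary: I f rule: finite_induct)
  case empty
  then have "I \<noteq> {}" by auto
  then show ?case by (intro exI[of _ "\<lambda>_. 1"]) auto
next
  case (insert k0 K)
  show ?case
  proof (cases "\<forall>i\<in>I. f k0 i = 0")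
    case True
    have "card K < card I" using insert by simp
    from insert.IH[OF \<open>finite I\<close> this, of f] True show ?thesis by auto
  next
    case False
    then obtain i0 where i0: "i0 \<in> I" "f k0 i0 \<noteq> 0" by auto
    define I' where "I' = I - {i0}"
    have I': "finite I'" "I = insert i0 I'" "i0 \<notin> I'" using i0 insert.prems by (auto simp: I'_def)
    have "card K < card I'" using insert I' by simp
    from insert.IH[OF I'(1) this, of "\<lambda>k i. f k i - f k0 i / f k0 i0 * f k i0"]
    obtain \<tau> where nz: "\<exists>i\<in>I'. \<tau> i \<noteq> 0"
      and \<tau>: "\<And>k. k \<in> K \<Longrightarrow> (\<Sum>i\<in>I'. \<tau> i * (f k i - f k0 i / f k0 i0 * f k i0)) = 0" by blast
    define S where "S = (\<Sum>i\<in>I'. \<tau> i * f k0 i)"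
    define \<sigma> where "\<sigma> = \<tau>(i0 := - S / f k0 i0)"
    have sum: "(\<Sum>i\<in>I. \<sigma> i * f k i) = - S / f k0 i0 * f k i0 + (\<Sum>i\<in>I'. \<tau> i * f k i)" for k
    proof -
      have "(\<Sum>i\<in>I'. \<sigma> i * f k i) = (\<Sum>i\<in>I'. \<tau> i * f k i)"
        by (rule sum.cong) (use I' in \<open>auto simp: \<sigma>_def\<close>)
      then show ?thesis using I' by (simp add: \<sigma>_def)
    qed
    have "(\<Sum>i\<in>I. \<sigma> i * f k i) = 0" if "k \<in> insert k0 K" for k
    proof (cases "k = k0")
      case True
      then show ?thesis using i0 by (simp add: sum S_def)
    next
      case False
      with that have "k \<in> K" by simp
      have "(\<Sum>i\<in>I'. \<tau> i * f k i) - (\<Sum>i\<in>I'. \<tau> i * f k0 i) / f k0 i0 * f k i0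
          = (\<Sum>i\<in>I'. \<tau> i * (f k i - f k0 i / f k0 i0 * f k i0))"
        unfolding sum_distrib_right sum_divide_distrib sum_subtractf[symmetric]
        by (intro sum.cong refl) (simp add: algebra_simps)
      also note \<tau>[OF \<open>k \<in> K\<close>]
      finally have "(\<Sum>i\<in>I'. \<tau> i * f k i) - (\<Sum>i\<in>I'. \<tau> i * f k0 i) / f k0 i0 * f k i0 = 0" .
      then show ?thesis by (simp add: sum S_def)
    qed
    moreover have "\<exists>i\<in>I. \<sigma> i \<noteq> 0" using nz I' by (auto simp: \<sigma>_def)
    ultimately show ?thesis by blast
  qed
qed

text \<open>  The dimension \<open>n\<close> is a variable, so vectors of \<open>\<real>\<^sup>n\<close> are sequences of which the first \<open>n\<close> entries
  matter.\<close>

definition inner_upto :: "nat \<Rightarrow> (nat \<Rightarrow> real) \<Rightarrow> (nat \<Rightarrow> real) \<Rightarrow> real" where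
  "inner_upto n y z = (\<Sum>a<n. y a * z a)"

definition energy :: "'i set \<Rightarrow> nat \<Rightarrow> ('i \<Rightarrow> real) \<Rightarrow> ('i \<Rightarrow> nat \<Rightarrow> real) \<Rightarrow> real" where
  "energy J n w y = (\<Sum>l\<in>J. \<Sum>k\<in>J. w l * w k * \<bar>inner_upto n (y l) (y k)\<bar>)"

text \<open>  The cube of side \<open>1/n\<close> that contains the direction of \<open>y\<close>. The zero vector, for which the
  quotients are \<open>0\<close> by convention, is harmless because its inner products vanish.\<close>

definition direction_cell :: "nat \<Rightarrow> (nat \<Rightarrow> real) \<Rightarrow> nat \<Rightarrow> int" where
  "direction_cell n y = (\<lambda>a\<in>{..<n}. \<lfloor>real n * y a / sqrt (inner_upto n y y)\<rfloor>)"

lemma inner_upto_self_nonneg: "0 \<le> inner_upto n y y"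
  by (auto simp: inner_upto_def intro: sum_nonneg)

lemma direction_cell_range:
  "direction_cell n y \<in> {..<n} \<rightarrow>\<^sub>E {- int n..int n}"
proof -
  have "\<lfloor>real n * y a / sqrt (inner_upto n y y)\<rfloor> \<in> {- int n..int n}" if "a < n" for a
  proof -
    define r where "r = sqrt (inner_upto n y y)"
    have r0: "0 \<le> r" by (simp add: r_def inner_upto_self_nonneg)
    have "(y a)\<^sup>2 \<le> inner_upto n y y"
      unfolding inner_upto_def power2_eq_square using that
      by (intro member_le_sum[of a "{..<n}" "\<lambda>a. y a * y a"]) auto
    then have "\<bar>y a\<bar> \<le> r" unfolding r_def by (metis real_sqrt_le_mono real_sqrt_abs)
    then have "\<bar>y a / r\<bar> \<le> 1" using r0 by (auto simp: abs_divide divide_le_eq_1)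
    then have q: "- 1 \<le> y a / r" "y a / r \<le> 1" by linarith+
    have "real n * (y a / r) \<le> real n * 1" by (rule mult_left_mono) (use q in auto)
    moreover have "real n * (-1) \<le> real n * (y a / r)" by (rule mult_left_mono) (use q in auto)
    ultimately show ?thesis unfolding r_def[symmetric] 
      by (simp add: le_floor_iff floor_le_iff)
  qed
  then show ?thesis by (auto simp: direction_cell_def)
qed

text \<open>  Unit vectors in a common cube of side \<open>1/n\<close> have squared distance \<open>2 - 2\<langle>u, v\<rangle>\<close> at most
  \<open>n (1/n)\<^sup>2 \<le> 1\<close>, hence a positive inner product.\<close>

lemma same_cell_inner_nonneg:
  assumes "direction_cell n y = direction_cell n z"
  shows "0 \<le> inner_upto n y z"
proof (cases "inner_upto n y y = 0 \<or> inner_upto n z z = 0")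
  case True
  have "\<forall>a<n. y a = 0" if "inner_upto n y y = 0" for y
    using that by (auto simp: inner_upto_def sum_nonneg_eq_0_iff)
  then have "y a * z a = 0" if "a < n" for a using True that by force
  then have "inner_upto n y z = 0" unfolding inner_upto_def by (intro sum.neutral) auto
  then show ?thesis by simp
next
  case False
  define r where "r = sqrt (inner_upto n y y)"
  define s where "s = sqrt (inner_upto n z z)"
  have rs: "r > 0" "s > 0" using False inner_upto_self_nonneg[of n y] inner_upto_self_nonneg[of n z]
    by (auto simp: r_def s_def)
  have r2: "r\<^sup>2 = inner_upto n y y" "s\<^sup>2 = inner_upto n z z"
    by (auto simp: r_def s_def inner_upto_self_nonneg)
  have n: "n > 0" using False by (auto simp: inner_upto_def intro: Nat.gr0I)
  have d: "(y a / r - z a / s)\<^sup>2 \<le> 1 / real n" if "a < n" for a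
  proof -
    have "\<lfloor>real n * y a / r\<rfloor> = \<lfloor>real n * z a / s\<rfloor>"
      using fun_cong[OF assms, of a] that by (simp add: direction_cell_def r_def s_def)
    then have "\<bar>real n * y a / r - real n * z a / s\<bar> \<le> 1" by linarith
    also have "real n * y a / r - real n * z a / s = real n * (y a / r - z a / s)"
      by (simp add: algebra_simps)
    finally have "real n * \<bar>y a / r - z a / s\<bar> \<le> 1" by (simp add: abs_mult)
    then have e: "\<bar>y a / r - z a / s\<bar> \<le> 1 / real n" using n by (simp add: field_simps)
    then have "(y a / r - z a / s)\<^sup>2 \<le> (1 / real n)\<^sup>2"
      by (metis abs_ge_zero power2_abs power_mono)
    also have "\<dots> \<le> 1 / real n" using n by (simp add: power2_eq_square field_simps)
    finally show ?thesis .
  qed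
  have "(\<Sum>a<n. (y a / r - z a / s)\<^sup>2) \<le> (\<Sum>a<n. 1 / real n)"
    by (rule sum_mono) (use d in auto)
  also have "\<dots> = 1" using n by simp
  finally have "(\<Sum>a<n. (y a / r - z a / s)\<^sup>2) \<le> 1" .
  moreover have "(\<Sum>a<n. (y a / r - z a / s)\<^sup>2) =
      inner_upto n y y / r\<^sup>2 - 2 * inner_upto n y z / (r * s) + inner_upto n z z / s\<^sup>2"
  proof -
    have "(y a / r - z a / s)\<^sup>2 = y a * y a / r\<^sup>2 - 2 * (y a * z a) / (r * s) + z a * z a / s\<^sup>2" for a
      by (simp add: power2_eq_square algebra_simps)
    then show ?thesis
      by (simp add: inner_upto_def sum.distrib sum_subtractf flip: sum_divide_distrib sum_distrib_left)
  qed
  ultimately have "2 * inner_upto n y z / (r * s) \<ge> 1"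
    using rs False by (simp add: r2)
  then have "inner_upto n y z / (r * s) \<ge> 0" by simp
  then show ?thesis using rs by (simp add: zero_le_divide_iff zero_less_mult_iff)
       (use mult_pos_pos[OF rs] in linarith)
qed

text \<open>  The number of cells times the number of linear constraints, namely the total mass and the second
  moments.\<close>

definition support_bound :: "nat \<Rightarrow> nat" where
  "support_bound n = (2 * n + 1) ^ n * (n * n + 1)"

text \<open>  Some cell contains more points of the support than there are constraints, so there is a direction
  \<open>\<tau>\<close>, supported in that cell, along which the constraints do not change. Along \<open>\<tau>\<close> the energy is a
  quadratic polynomial whose leading coefficient is \<open>\<Sum>\<^sub>a (\<Sum>\<^sub>l \<tau>\<^sub>l y\<^sub>l(a))\<^sup>2 \<ge> 0\<close>; with the right sign of
  \<open>\<tau>\<close> it does not decrease up to the moment when a first weight vanishes.\<close>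

lemma weight_reduction_step:
  fixes y :: "'i \<Rightarrow> nat \<Rightarrow> real"
  assumes J: "finite J" and nn: "\<And>l. l \<in> J \<Longrightarrow> 0 \<le> w l"
    and big: "support_bound n < card {l\<in>J. w l \<noteq> 0}"
  obtains w' where "\<And>l. l \<in> J \<Longrightarrow> 0 \<le> w' l" "sum w' J = sum w J"
    "\<And>a b. a < n \<Longrightarrow> b < n \<Longrightarrow> (\<Sum>l\<in>J. w' l * y l a * y l b) = (\<Sum>l\<in>J. w l * y l a * y l b)"
    "energy J n w y \<le> energy J n w' y" "card {l\<in>J. w' l \<noteq> 0} < card {l\<in>J. w l \<noteq> 0}"
proof -
  define U where "U = {l\<in>J. w l \<noteq> 0}"
  have finU: "finite U" using J by (simp add: U_def)
  let ?C = "{..<n} \<rightarrow>\<^sub>E {- int n..int n}"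
  have cC: "card ?C = (2 * n + 1) ^ n" by (subst card_PiE) (simp_all add: nat_add_distrib nat_mult_distrib)
  have finC: "finite ?C" by (auto intro!: finite_PiE)
  \<comment> \<open>pigeonhole: some cell contains more points of the support than there are constraints\<close>
  have "\<exists>c\<in>?C. n * n + 1 < card {l\<in>U. direction_cell n (y l) = c}"
  proof (rule ccontr)
    assume "\<not> ?thesis"
    then have le: "card {l\<in>U. direction_cell n (y l) = c} \<le> n * n + 1" if "c \<in> ?C" for c
      using that not_less by blast
    have "U = (\<Union>c\<in>?C. {l\<in>U. direction_cell n (y l) = c})"
      using direction_cell_range by fastforce
    then have "card U \<le> (\<Sum>c\<in>?C. card {l\<in>U. direction_cell n (y l) = c})"
      using card_UN_le[OF finC, of "\<lambda>c. {l\<in>U. direction_cell n (y l) = c}"] by argo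
    also have "\<dots> \<le> (\<Sum>c\<in>?C. n * n + 1)" by (rule sum_mono) (use le in auto)
    also have "\<dots> = support_bound n" by (simp add: cC support_bound_def)
    finally show False using big by (simp add: U_def)
  qed
  then obtain c where c: "n * n + 1 < card {l\<in>U. direction_cell n (y l) = c}" by blast
  define I where "I = {l\<in>U. direction_cell n (y l) = c}"
  have I: "I \<subseteq> J" "I \<subseteq> U" by (auto simp: I_def U_def)
  have finI: "finite I" using finite_subset[OF I(2) finU] .
  define K where "K = insert None (Some ` ({..<n} \<times> {..<n}))"
  have K: "finite K" "card K = n * n + 1"
    by (auto simp: K_def card_image card_insert_if)
  define f where "f k l = (case k of None \<Rightarrow> 1 | Some (a, b) \<Rightarrow> y l a * y l b)" for k l
  have "card K < card I" using c K by (simp add: I_def)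
  from homogeneous_system_nontrivial_solution[OF K(1) finI this, of f]
  obtain \<tau>0 where nz0: "\<exists>l\<in>I. \<tau>0 l \<noteq> 0" and \<tau>0: "\<And>k. k \<in> K \<Longrightarrow> (\<Sum>l\<in>I. \<tau>0 l * f k l) = 0"
    by blast
  define L where "L \<tau> = (\<Sum>l\<in>J. \<Sum>k\<in>J. w l * \<tau> k * \<bar>inner_upto n (y l) (y k)\<bar>)" for \<tau>
  define \<tau>1 where "\<tau>1 l = (if l \<in> I then \<tau>0 l else 0)" for l
  \<comment> \<open>the sign makes the linear term of the energy along \<open>\<tau>\<close> nonnegative\<close>
  define \<tau> where "\<tau> l = (if L \<tau>1 \<ge> 0 then 1 else -1) * \<tau>1 l" for l
  have L: "L \<tau> \<ge> 0"
  proof -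
    have "L \<tau> = (if L \<tau>1 \<ge> 0 then 1 else -1) * L \<tau>1"
      unfolding L_def \<tau>_def sum_distrib_left by (intro sum.cong refl) (simp add: ac_simps)
    then show ?thesis by auto
  qed
  have off: "\<tau> l = 0" if "l \<notin> I" for l using that by (simp add: \<tau>_def \<tau>1_def)
  have nz: "\<exists>l\<in>I. \<tau> l \<noteq> 0" using nz0 by (auto simp: \<tau>_def \<tau>1_def)
  have sumJ: "(\<Sum>l\<in>J. \<tau> l * h l) = (\<Sum>l\<in>I. \<tau> l * h l)" for h
    by (rule sum.mono_neutral_right) (use J I off in auto)
  have mom: "(\<Sum>l\<in>I. \<tau> l * f k l) = 0" if "k \<in> K" for k
  proof -
    have "(\<Sum>l\<in>I. \<tau> l * f k l) = (if L \<tau>1 \<ge> 0 then 1 else -1) * (\<Sum>l\<in>I. \<tau>0 l * f k l)"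
      unfolding sum_distrib_left by (rule sum.cong) (auto simp: \<tau>_def \<tau>1_def)
    then show ?thesis using \<tau>0[OF that] by simp
  qed
  have mass0: "(\<Sum>l\<in>I. \<tau> l) = 0" using mom[of None] by (simp add: K_def f_def)
  then have massJ: "sum \<tau> J = 0" using sumJ[of "\<lambda>_. 1"] by simp
  have momJ: "(\<Sum>l\<in>J. \<tau> l * (y l a * y l b)) = 0" if "a < n" "b < n" for a b
    using mom[of "Some (a, b)"] that by (simp add: sumJ K_def f_def)
  \<comment> \<open>the entries of \<open>\<tau>\<close> sum to \<open>0\<close>, so a weight that vanishes first does exist\<close>
  have "\<exists>l\<in>I. \<tau> l < 0"
  proof (rule ccontr)
    assume "\<not> ?thesis"
    then have "\<And>l. l \<in> I \<Longrightarrow> 0 \<le> \<tau> l" by (simp add: not_less)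
    from sum_nonneg_eq_0_iff[OF finI this] have "\<forall>l\<in>I. \<tau> l = 0" using mass0 by simp
    then show False using nz by blast
  qed
  define R where "R = (\<lambda>l. w l / (- \<tau> l)) ` {l\<in>I. \<tau> l < 0}"
  have R: "finite R" "R \<noteq> {}" using finI \<open>\<exists>l\<in>I. \<tau> l < 0\<close> by (auto simp: R_def)
  define t where "t = Min R"
  obtain l0 where l0: "l0 \<in> I" "\<tau> l0 < 0" "t = w l0 / (- \<tau> l0)"
    using Min_in[OF R] by (auto simp: t_def R_def)
  have tle: "t \<le> w l / (- \<tau> l)" if "l \<in> I" "\<tau> l < 0" for l
    unfolding t_def by (rule Min_le) (use R that in \<open>auto simp: R_def\<close>)
  have nnI: "0 \<le> w l" if "l \<in> I" for l using nn that I by auto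
  have t0: "0 \<le> t" using l0 nnI[OF l0(1)] by (simp add: divide_nonneg_neg)
  define w' where "w' l = w l + t * \<tau> l" for l
  show thesis
  proof (rule that[of w'])
    fix l assume l: "l \<in> J"
    show "0 \<le> w' l"
    proof (cases "\<tau> l < 0")
      case True
      then have "l \<in> I" using off by force
      from tle[OF this True] True show ?thesis by (simp add: w'_def field_simps)
    next
      case False
      then show ?thesis using nn[OF l] t0 by (simp add: w'_def)
    qed
  next
    show "sum w' J = sum w J"
      by (simp add: w'_def sum.distrib massJ flip: sum_distrib_left)
  next
    fix a b assume "a < n" "b < n"
    note m = momJ[OF this]
    have "(\<Sum>l\<in>J. w' l * y l a * y l b)
        = (\<Sum>l\<in>J. w l * y l a * y l b) + t * (\<Sum>l\<in>J. \<tau> l * (y l a * y l b))"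
      unfolding sum_distrib_left sum.distrib[symmetric]
      by (intro sum.cong refl) (simp add: w'_def algebra_simps)
    then show "(\<Sum>l\<in>J. w' l * y l a * y l b) = (\<Sum>l\<in>J. w l * y l a * y l b)"
      using m by simp
  next
    have "{l\<in>J. w' l \<noteq> 0} \<subset> U"
    proof
      show "{l\<in>J. w' l \<noteq> 0} \<subseteq> U" using off I by (force simp: w'_def U_def)
      show "{l\<in>J. w' l \<noteq> 0} \<noteq> U" using l0 I by (auto simp: w'_def)
    qed
    then show "card {l\<in>J. w' l \<noteq> 0} < card {l\<in>J. w l \<noteq> 0}"
      using finU psubset_card_mono by (metis U_def)
  next
    define G where "G l k = \<bar>inner_upto n (y l) (y k)\<bar>" for l k
    have Gsym: "G l k = G k l" for l k by (simp add: G_def inner_upto_def mult.commute)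
    have "energy J n w' y = energy J n w y + t * L \<tau> + t * (\<Sum>l\<in>J. \<Sum>k\<in>J. \<tau> l * w k * G l k)
        + t * t * (\<Sum>l\<in>J. \<Sum>k\<in>J. \<tau> l * \<tau> k * G l k)"
    proof -
      have "w' l * w' k * G l k = w l * w k * G l k + t * (w l * \<tau> k * G l k)
          + t * (\<tau> l * w k * G l k) + t * t * (\<tau> l * \<tau> k * G l k)" for l k
        by (simp add: w'_def algebra_simps)
      then show ?thesis unfolding energy_def L_def G_def[symmetric]
        by (simp only: sum.distrib sum_distrib_left[symmetric])
    qed
    moreover have "(\<Sum>l\<in>J. \<Sum>k\<in>J. \<tau> l * w k * G l k) = L \<tau>"
      unfolding L_def G_def[symmetric]
      by (subst sum.swap, intro sum.cong refl) (subst Gsym, simp)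
    moreover have "(\<Sum>l\<in>J. \<Sum>k\<in>J. \<tau> l * \<tau> k * G l k) = (\<Sum>a<n. (\<Sum>l\<in>J. \<tau> l * y l a)\<^sup>2)"
    proof -
      have "\<tau> l * \<tau> k * G l k = (\<Sum>a<n. (\<tau> l * y l a) * (\<tau> k * y k a))" for l k
      proof (cases "l \<in> I \<and> k \<in> I")
        case True
        then have "G l k = inner_upto n (y l) (y k)"
          using same_cell_inner_nonneg[of n "y l" "y k"] by (simp add: I_def G_def)
        then show ?thesis unfolding inner_upto_def sum_distrib_left
          by (simp only: sum_distrib_left) (intro sum.cong refl, simp)
      next
        case False
        then show ?thesis using off by auto
      qed
      then have "(\<Sum>l\<in>J. \<Sum>k\<in>J. \<tau> l * \<tau> k * G l k)
          = (\<Sum>l\<in>J. \<Sum>k\<in>J. \<Sum>a<n. (\<tau> l * y l a) * (\<tau> k * y k a))" by simp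
      also have "\<dots> = (\<Sum>l\<in>J. \<Sum>a<n. \<Sum>k\<in>J. (\<tau> l * y l a) * (\<tau> k * y k a))"
        by (rule sum.cong[OF refl], rule sum.swap)
      also have "\<dots> = (\<Sum>a<n. \<Sum>l\<in>J. \<Sum>k\<in>J. (\<tau> l * y l a) * (\<tau> k * y k a))"
        by (rule sum.swap)
      also have "\<dots> = (\<Sum>a<n. (\<Sum>l\<in>J. \<tau> l * y l a)\<^sup>2)"
        by (simp add: power2_eq_square sum_product)
      finally show ?thesis .
    qed
    moreover have "0 \<le> (\<Sum>a<n. (\<Sum>l\<in>J. \<tau> l * y l a)\<^sup>2)" by (simp add: sum_nonneg)
    ultimately show "energy J n w y \<le> energy J n w' y" using t0 L by simp
  qed
qed

lemma weight_reduction: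
  fixes y :: "'i \<Rightarrow> nat \<Rightarrow> real"
  assumes J: "finite J" and nn: "\<And>l. l \<in> J \<Longrightarrow> 0 \<le> w l"
  shows "\<exists>w'. (\<forall>l\<in>J. 0 \<le> w' l) \<and> sum w' J = sum w J
    \<and> (\<forall>a<n. \<forall>b<n. (\<Sum>l\<in>J. w' l * y l a * y l b) = (\<Sum>l\<in>J. w l * y l a * y l b))
    \<and> energy J n w y \<le> energy J n w' y \<and> card {l\<in>J. w' l \<noteq> 0} \<le> support_bound n"
  using nn
proof (induction "card {l\<in>J. w l \<noteq> 0}" arbitrary: w rule: less_induct)
  case less
  show ?case
  proof (cases "support_bound n < card {l\<in>J. w l \<noteq> 0}")
    case True
    obtain w1 where 1: "\<And>l. l \<in> J \<Longrightarrow> 0 \<le> w1 l" "sum w1 J = sum w J"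
    "\<And>a b. a < n \<Longrightarrow> b < n \<Longrightarrow> (\<Sum>l\<in>J. w1 l * y l a * y l b) = (\<Sum>l\<in>J. w l * y l a * y l b)"
    "energy J n w y \<le> energy J n w1 y" "card {l\<in>J. w1 l \<noteq> 0} < card {l\<in>J. w l \<noteq> 0}"
      using weight_reduction_step[OF J less.prems True, where y=y] by blast
    from less.hyps[OF 1(5) 1(1)] obtain w' where 2: "\<forall>l\<in>J. 0 \<le> w' l" "sum w' J = sum w1 J"
      "\<forall>a<n. \<forall>b<n. (\<Sum>l\<in>J. w' l * y l a * y l b) = (\<Sum>l\<in>J. w1 l * y l a * y l b)"
      "energy J n w1 y \<le> energy J n w' y" "card {l\<in>J. w' l \<noteq> 0} \<le> support_bound n" by blast
    show ?thesis
      by (rule exI[of _ w'], intro conjI) (use 1 2 in \<open>auto intro: order_trans\<close>)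
  next
    case False
    then show ?thesis using less.prems by (intro exI[of _ w]) auto
  qed
qed

section \<open>Bounded sequences and bases of their finite-dimensional subspaces\<close>

lemma apply_Bcontfun_bounded:
  fixes f :: "nat \<Rightarrow> 'b::real_normed_vector"
  assumes "\<And>i. norm (f i) \<le> B"
  shows "apply_bcontfun (Bcontfun f) = f"
proof (rule Bcontfun_inverse, rule bcontfun_normI)
  show "continuous_on UNIV f" by (simp add: continuous_on_discrete)
qed (rule assms)

text \<open>  Sequences with values in a normed space occur with real entries, as unit vectors, and with
  entries in \<^typ>\<open>linf\<close>, where a finitely supported sequence \<open>a\<close> stands for the finite-rank operator
  \<open>z \<mapsto> \<Sum>\<^sub>j z\<^sub>j a\<^sub>j\<close>.\<close>

definition single :: "nat \<Rightarrow> 'b::real_normed_vector \<Rightarrow> nat \<Rightarrow>\<^sub>C 'b" where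
  "single j z = Bcontfun (\<lambda>i. if i = j then z else 0)"

lemma apply_single [simp]: "apply_bcontfun (single j z) i = (if i = j then z else 0)"
  unfolding single_def by (subst apply_Bcontfun_bounded[where B = "norm z"]) auto

lemma apply_bcontfun_sum [simp]:
  "apply_bcontfun (\<Sum>j\<in>J. f j) i = (\<Sum>j\<in>J. apply_bcontfun (f j) i)"
  by (induction J rule: infinite_finite_induct) auto

text \<open>  A basis in reduced echelon form: the coordinates of a vector of \<open>E\<close> are its entries at the pivot
  positions \<open>i a\<close>. Its coordinate functionals are therefore evaluations.\<close>

definition pivot_basis :: "nat \<Rightarrow> linf set \<Rightarrow> (nat \<Rightarrow> linf) \<Rightarrow> (nat \<Rightarrow> nat) \<Rightarrow> bool" where
  "pivot_basis n E x i \<longleftrightarrow> (\<forall>a<n. x a \<in> E) \<and>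
     (\<forall>a<n. \<forall>b<n. apply_bcontfun (x a) (i b) = (if a = b then 1 else 0)) \<and>
     (\<forall>z\<in>E. z = (\<Sum>a<n. apply_bcontfun z (i a) *\<^sub>R x a))"

lemma pivot_basis_span_exists:
  assumes "finite B" "independent B"
  shows "\<exists>x i. pivot_basis (card B) (span B) x i"
  using assms
proof (induction B rule: finite_induct)
  case empty
  show ?case by (auto simp: pivot_basis_def)
next
  case (insert b B)
  define n where "n = card B"
  have indB: "independent B" and bB: "b \<notin> span B"
    using insert by (auto simp: independent_insert)
  obtain x i where xi: "pivot_basis n (span B) x i" using insert.IH[OF indB] n_def by blast
  have xB: "x a \<in> span B" if "a < n" for a using xi that by (auto simp: pivot_basis_def)
  have biorth: "apply_bcontfun (x a) (i c) = (if a = c then 1 else 0)" if "a < n" "c < n" for a c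
    using xi that by (auto simp: pivot_basis_def)
  have expand: "z = (\<Sum>a<n. apply_bcontfun z (i a) *\<^sub>R x a)" if "z \<in> span B" for z
    using xi that by (auto simp: pivot_basis_def)
  define u where "u = b - (\<Sum>a<n. apply_bcontfun b (i a) *\<^sub>R x a)"
  have sumB: "(\<Sum>a<n. f a *\<^sub>R x a) \<in> span B" for f
    by (intro span_sum span_scale xB) auto
  have u0: "u \<noteq> 0"
  proof
    assume "u = 0"
    then have "b = (\<Sum>a<n. apply_bcontfun b (i a) *\<^sub>R x a)" by (simp add: u_def)
    then show False using bB sumB[of "\<lambda>a. apply_bcontfun b (i a)"] by argo
  qed
  then obtain j where j: "apply_bcontfun u j \<noteq> 0"
    by (metis bcontfun_eqI zero_bcontfun.rep_eq)
  define \<alpha> where "\<alpha> = apply_bcontfun u j"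
  define w where "w = (1 / \<alpha>) *\<^sub>R u"
  have wj: "apply_bcontfun w j = 1" using j by (simp add: w_def \<alpha>_def)
  have uw: "u = \<alpha> *\<^sub>R w" using j by (simp add: w_def \<alpha>_def)
  have ui: "apply_bcontfun u (i c) = 0" if "c < n" for c
  proof -
    have "(\<Sum>a<n. apply_bcontfun b (i a) * apply_bcontfun (x a) (i c))
        = (\<Sum>a<n. apply_bcontfun b (i a) * (if a = c then 1 else 0))"
      by (rule sum.cong) (use biorth that in auto)
    then show ?thesis using that by (simp add: u_def mult_delta_right)
  qed
  have wi: "apply_bcontfun w (i c) = 0" if "c < n" for c using ui[OF that] by (simp add: w_def)
  define x' where "x' a = (if a < n then x a - apply_bcontfun (x a) j *\<^sub>R w else w)" for a
  define i' where "i' a = (if a < n then i a else j)" for a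
  have bI: "b \<in> span (insert b B)" by (simp add: span_base)
  have incl: "span B \<subseteq> span (insert b B)" by (rule span_mono) auto
  have "u \<in> span (insert b B)" unfolding u_def using bI incl sumB by (meson span_diff subsetD)
  then have wI: "w \<in> span (insert b B)" unfolding w_def by (rule span_scale)
  have "pivot_basis (Suc n) (span (insert b B)) x' i'"
    unfolding pivot_basis_def
  proof (intro conjI allI impI ballI)
    fix a show "x' a \<in> span (insert b B)"
      unfolding x'_def using wI xB[of a] incl by (auto intro!: span_diff span_scale)
  next
    fix a c assume "a < Suc n" "c < Suc n"
    then show "apply_bcontfun (x' a) (i' c) = (if a = c then 1 else 0)"
      using biorth wj wi by (auto simp: x'_def i'_def less_Suc_eq)
  next
    fix z assume "z \<in> span (insert b B)"
    then obtain k where k: "z - k *\<^sub>R b \<in> span B" using span_breakdown_eq by blast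
    define v where "v = z - k *\<^sub>R b + (k *\<^sub>R (\<Sum>a<n. apply_bcontfun b (i a) *\<^sub>R x a))"
    have v: "v \<in> span B" unfolding v_def using k sumB by (intro span_add span_scale)
    have "k *\<^sub>R u = k *\<^sub>R (\<alpha> *\<^sub>R w)" using uw by simp
    then have z: "z = (k * \<alpha>) *\<^sub>R w + v" by (simp add: v_def u_def algebra_simps)
    have zi: "apply_bcontfun z (i a) = apply_bcontfun v (i a)" if "a < n" for a
      using wi[OF that] by (simp add: z)
    have vj: "apply_bcontfun v j = (\<Sum>a<n. apply_bcontfun v (i a) * apply_bcontfun (x a) j)"
      using arg_cong[OF expand[OF v], of "\<lambda>f. apply_bcontfun f j"] by simp
    have "(\<Sum>a<Suc n. apply_bcontfun z (i' a) *\<^sub>R x' a)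
        = (\<Sum>a<n. apply_bcontfun v (i a) *\<^sub>R (x a - apply_bcontfun (x a) j *\<^sub>R w))
          + (k * \<alpha> + apply_bcontfun v j) *\<^sub>R w"
    proof -
      have "(\<Sum>a<n. apply_bcontfun z (i' a) *\<^sub>R x' a)
          = (\<Sum>a<n. apply_bcontfun v (i a) *\<^sub>R (x a - apply_bcontfun (x a) j *\<^sub>R w))"
        by (rule sum.cong) (simp_all add: x'_def i'_def zi)
      then show ?thesis by (simp add: x'_def i'_def z wj)
    qed
    also have "(\<Sum>a<n. apply_bcontfun v (i a) *\<^sub>R (x a - apply_bcontfun (x a) j *\<^sub>R w))
        = (\<Sum>a<n. apply_bcontfun v (i a) *\<^sub>R x a) - apply_bcontfun v j *\<^sub>R w"
      unfolding vj by (simp add: scaleR_diff_right sum_subtractf scaleR_sum_left)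
    also have "(\<Sum>a<n. apply_bcontfun v (i a) *\<^sub>R x a) = v" using expand[OF v] by simp
    finally show "z = (\<Sum>a<Suc n. apply_bcontfun z (i' a) *\<^sub>R x' a)"
      by (simp add: z algebra_simps)
  qed
  moreover have "card (insert b B) = Suc n" using insert by (simp add: n_def)
  ultimately show ?case by auto
qed

lemma subspace_of_dim_basis:
  assumes "subspace_of_dim n V"
  obtains B where "finite B" "independent B" "span B = V" "card B = n"
proof -
  from assms obtain B0 where B0: "finite B0" "span B0 = V" and V: "dim V = n"
    by (auto simp: subspace_of_dim_def)
  obtain B where B: "B \<subseteq> B0" "independent B" "B0 \<subseteq> span B"
    by (rule maximal_independent_subset)
  have fin: "finite B" using B B0 finite_subset by blast
  have sp: "span B = V" using B B0 by (metis span_mono span_span subset_antisym)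
  then have "card B = n" using V B(2) by (metis dim_eq_card_independent dim_span)
  with that fin B sp show thesis by blast
qed

lemma subspace_of_dimI:
  assumes "finite B" "independent B" "span B = V" "card B = n"
  shows "subspace_of_dim n V"
  using assms unfolding subspace_of_dim_def
  by (metis dim_eq_card_independent dim_span subspace_span)

lemma pivot_basis_exists:
  assumes "subspace_of_dim n E"
  obtains x i where "pivot_basis n E x i"
  using subspace_of_dim_basis[OF assms] pivot_basis_span_exists by metis

section \<open>An energy bound yields small projections\<close>

text \<open>  Weights may vanish, so \<open>\<beta>\<close> is only positive semidefinite, and a vector whose orthogonal remainder
  has length \<open>0\<close> is dropped. Such a remainder vanishes at every position of nonzero weight, which is
  why the orthonormal expansion still holds there.\<close>

lemma weighted_gram_schmidt:
  fixes B :: "linf set" and \<mu> :: "nat \<Rightarrow> real" and J :: "nat set"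
  defines "\<beta> \<equiv> \<lambda>x z. \<Sum>j\<in>J. \<mu> j * apply_bcontfun x j * apply_bcontfun z j"
  assumes B: "finite B" and J: "finite J" and \<mu>: "\<And>j. j \<in> J \<Longrightarrow> 0 \<le> \<mu> j"
  shows "\<exists>r\<le>card B. \<exists>x. (\<forall>a<r. x a \<in> span B) \<and>
     (\<forall>a<r. \<forall>c<r. \<beta> (x a) (x c) = (if a = c then 1 else 0)) \<and>
     (\<forall>z\<in>span B. \<forall>j\<in>J. \<mu> j \<noteq> 0 \<longrightarrow> apply_bcontfun z j = (\<Sum>a<r. \<beta> (x a) z * apply_bcontfun (x a) j))"
  using B
proof (induction B rule: finite_induct)
  case empty
  show ?case by (intro exI[of _ 0]) auto
next
  case (insert b B)
  obtain r x where r: "r \<le> card B" and xB: "\<And>a. a < r \<Longrightarrow> x a \<in> span B"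
    and on: "\<And>a c. a < r \<Longrightarrow> c < r \<Longrightarrow> \<beta> (x a) (x c) = (if a = c then 1 else 0)"
    and ex: "\<And>z j. z \<in> span B \<Longrightarrow> j \<in> J \<Longrightarrow> \<mu> j \<noteq> 0 \<Longrightarrow>
        apply_bcontfun z j = (\<Sum>a<r. \<beta> (x a) z * apply_bcontfun (x a) j)"
    using insert.IH by blast
  have badd: "\<beta> x (y + z) = \<beta> x y + \<beta> x z" "\<beta> x (y - z) = \<beta> x y - \<beta> x z"
    "\<beta> x (c *\<^sub>R y) = c * \<beta> x y" for x y z c
    by (simp_all add: \<beta>_def algebra_simps sum.distrib sum_subtractf sum_distrib_left)
  have bsum: "\<beta> x (\<Sum>a<m. f a *\<^sub>R y a) = (\<Sum>a<m. f a * \<beta> x (y a))" for x f y and m :: nat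
    by (induction m) (simp_all add: badd, simp add: \<beta>_def)
  have bsym: "\<beta> x y = \<beta> y x" for x y by (simp add: \<beta>_def mult.commute mult.left_commute)
  have incl: "span B \<subseteq> span (insert b B)" by (rule span_mono) auto
  define u where "u = b - (\<Sum>a<r. \<beta> (x a) b *\<^sub>R x a)"
  have bI: "b \<in> span (insert b B)" by (simp add: span_base)
  have uI: "u \<in> span (insert b B)" unfolding u_def
    using xB incl bI by (auto intro!: span_diff span_sum span_scale)
  have ux: "\<beta> (x c) u = 0" if "c < r" for c
  proof -
    have "(\<Sum>a<r. \<beta> (x a) b * \<beta> (x c) (x a)) = (\<Sum>a<r. \<beta> (x a) b * (if a = c then 1 else 0))"
      by (rule sum.cong) (use on that in auto)
    then show ?thesis using that by (simp add: u_def badd bsum mult_delta_right)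
  qed
  have card: "card (insert b B) = Suc (card B)" using insert by simp
  show ?case
  proof (cases "\<beta> u u = 0")
    case True
    have u0: "apply_bcontfun u j = 0" if "j \<in> J" "\<mu> j \<noteq> 0" for j
    proof -
      have "(\<Sum>j\<in>J. \<mu> j * (apply_bcontfun u j * apply_bcontfun u j)) = 0"
        using True by (simp add: \<beta>_def mult.assoc)
      moreover have "0 \<le> \<mu> j * (apply_bcontfun u j * apply_bcontfun u j)" if "j \<in> J" for j
        using \<mu>[OF that] by simp
      ultimately have "\<mu> j * (apply_bcontfun u j * apply_bcontfun u j) = 0"
        using sum_nonneg_eq_0_iff[OF J] that by (metis (no_types, lifting))
      then show ?thesis using that by simp
    qed
    show ?thesis
    proof (intro exI[of _ r] exI[of _ x] conjI allI impI ballI)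
      show "r \<le> card (insert b B)" using r card by simp
      show "x a \<in> span (insert b B)" if "a < r" for a using xB[OF that] incl by blast
      show "\<beta> (x a) (x c) = (if a = c then 1 else 0)" if "a < r" "c < r" for a c using on that by blast
      fix z j assume z: "z \<in> span (insert b B)" and j: "j \<in> J" "\<mu> j \<noteq> 0"
      obtain k where k: "z - k *\<^sub>R b \<in> span B" using z span_breakdown_eq by blast
      define v where "v = z - k *\<^sub>R b"
      have zv: "z = k *\<^sub>R b + v" by (simp add: v_def)
      have "apply_bcontfun v j = (\<Sum>a<r. \<beta> (x a) v * apply_bcontfun (x a) j)"
        using ex[OF _ j] k v_def by blast
      moreover have "apply_bcontfun b j = (\<Sum>a<r. \<beta> (x a) b * apply_bcontfun (x a) j)"
        using u0[OF j] by (simp add: u_def)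
      ultimately show "apply_bcontfun z j = (\<Sum>a<r. \<beta> (x a) z * apply_bcontfun (x a) j)"
        by (simp add: zv badd algebra_simps sum.distrib sum_distrib_left)
    qed
  next
    case False
    have "0 \<le> \<beta> u u" unfolding \<beta>_def using \<mu> by (auto intro!: sum_nonneg simp: mult.assoc)
    with False have pos: "0 < \<beta> u u" by simp
    define q where "q = sqrt (\<beta> u u)"
    have q: "q > 0" "q * q = \<beta> u u" using pos by (auto simp: q_def)
    define w where "w = (1 / q) *\<^sub>R u"
    have uw: "u = q *\<^sub>R w" using q by (simp add: w_def)
    have "\<beta> w w = \<beta> u u / (q * q)" by (simp add: w_def badd bsym[of "(1/q) *\<^sub>R u" u])
    then have ww: "\<beta> w w = 1" using q pos by simp
    have wx: "\<beta> (x c) w = 0" "\<beta> w (x c) = 0" if "c < r" for c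
      using ux[OF that] by (simp_all add: w_def badd bsym[of "(1/q) *\<^sub>R u" "x c"])
    define x' where "x' a = (if a < r then x a else w)" for a
    show ?thesis
    proof (intro exI[of _ "Suc r"] exI[of _ x'] conjI allI impI ballI)
      show "Suc r \<le> card (insert b B)" using r card by simp
      show "x' a \<in> span (insert b B)" for a
        using xB[of a] incl uI by (auto simp: x'_def w_def intro: span_scale)
      show "\<beta> (x' a) (x' c) = (if a = c then 1 else 0)" if "a < Suc r" "c < Suc r" for a c
        using on wx ww that by (auto simp: x'_def less_Suc_eq)
      fix z j assume z: "z \<in> span (insert b B)" and j: "j \<in> J" "\<mu> j \<noteq> 0"
      obtain k where k: "z - k *\<^sub>R b \<in> span B" using z span_breakdown_eq by blast
      define v where "v = z - k *\<^sub>R b"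
      have zv: "z = k *\<^sub>R b + v" by (simp add: v_def)
      have exv: "apply_bcontfun v j = (\<Sum>a<r. \<beta> (x a) v * apply_bcontfun (x a) j)"
        if "j \<in> J" "\<mu> j \<noteq> 0" for j
        using ex[OF _ that] k v_def by blast
      have b: "b = q *\<^sub>R w + (\<Sum>a<r. \<beta> (x a) b *\<^sub>R x a)" using uw by (simp add: u_def algebra_simps)
      have wv: "\<beta> w v = 0"
      proof -
        have "\<beta> w v = (\<Sum>j\<in>J. \<mu> j * apply_bcontfun w j * apply_bcontfun v j)" by (simp add: \<beta>_def)
        also have "\<dots> = (\<Sum>j\<in>J. \<mu> j * apply_bcontfun w j * (\<Sum>a<r. \<beta> (x a) v * apply_bcontfun (x a) j))"
          by (intro sum.cong refl) (use exv in fastforce)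
        also have "\<dots> = \<beta> w (\<Sum>a<r. \<beta> (x a) v *\<^sub>R x a)" by (simp add: \<beta>_def)
        also have "\<dots> = 0" using wx by (simp add: bsum)
        finally show ?thesis .
      qed
      have wb: "\<beta> w b = q"
        by (subst b) (simp add: badd bsum ww wx)
      have "apply_bcontfun b j = q * apply_bcontfun w j + (\<Sum>a<r. \<beta> (x a) b * apply_bcontfun (x a) j)"
        by (subst b) simp
      then show "apply_bcontfun z j = (\<Sum>a<Suc r. \<beta> (x' a) z * apply_bcontfun (x' a) j)"
        using exv[OF j] wv wb
        by (simp add: x'_def zv badd algebra_simps sum.distrib sum_distrib_left)
    qed
  qed
qed

text \<open>  The second moments are allowed to be a diagonal projection of rank \<open>r \<le> n\<close>, since the Gram--Schmidt
  process may produce fewer than \<open>n\<close> vectors.\<close>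

definition energy_bound :: "nat \<Rightarrow> real \<Rightarrow> bool" where
  "energy_bound n M \<longleftrightarrow> (\<forall>J w y r. finite (J :: nat set) \<longrightarrow> (\<forall>l\<in>J. 0 \<le> w l) \<longrightarrow> r \<le> n \<longrightarrow>
     (\<forall>a<n. \<forall>b<n. (\<Sum>l\<in>J. w l * y l a * y l b) = (if a = b \<and> a < r then 1 else 0)) \<longrightarrow>
     energy J n w y \<le> M * sum w J)"

text \<open>  Let \<open>\<beta>\<close> be the form with weights \<open>\<mu>\<^sub>j = \<parallel>a\<^sub>j\<parallel>\<close> and \<open>g\<^sub>c\<close> a \<open>\<beta>\<close>-orthonormal system as above. The
  operator \<open>v\<close> only sees positions of nonzero weight, so \<open>v z = \<Sum>\<^sub>c \<beta>(g\<^sub>c, z) v g\<^sub>c\<close> and its trace is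
  \<open>\<Sum>\<^sub>c \<beta>(g\<^sub>c, v g\<^sub>c) = \<Sum>\<^sub>l\<^sub>k \<mu>\<^sub>l a\<^sub>k(l) \<Sum>\<^sub>c g\<^sub>c(l) g\<^sub>c(k)\<close>. The claim follows from
  \<open>\<bar>a\<^sub>k(l)\<bar> \<le> \<mu>\<^sub>k\<close>.\<close>

lemma trace_bound:
  assumes M: "energy_bound n M" and dim: "subspace_of_dim n E" and piv: "pivot_basis n E x i"
    and J: "finite J" and v_def: "\<And>z. v z = (\<Sum>j\<in>J. apply_bcontfun z j *\<^sub>R a j)"
    and vE: "\<And>z. z \<in> E \<Longrightarrow> v z \<in> E"
  shows "(\<Sum>b<n. apply_bcontfun (v (x b)) (i b)) \<le> M * (\<Sum>j\<in>J. norm (a j))"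
proof -
  define \<mu> where "\<mu> j = norm (a j)" for j
  define \<beta> where "\<beta> x z = (\<Sum>j\<in>J. \<mu> j * apply_bcontfun x j * apply_bcontfun z j)" for x z
  obtain B where B: "finite B" "span B = E" "card B = n" using subspace_of_dim_basis[OF dim] by blast
  have xE: "x b \<in> E" if "b < n" for b using piv that by (auto simp: pivot_basis_def)
  have expand: "z = (\<Sum>b<n. apply_bcontfun z (i b) *\<^sub>R x b)" if "z \<in> E" for z
    using piv that by (auto simp: pivot_basis_def)
  have \<mu>: "\<And>j. j \<in> J \<Longrightarrow> 0 \<le> \<mu> j" by (simp add: \<mu>_def)
  have "\<exists>r\<le>n. \<exists>x. (\<forall>a<r. x a \<in> E) \<and>
     (\<forall>a<r. \<forall>c<r. \<beta> (x a) (x c) = (if a = c then 1 else 0)) \<and>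
     (\<forall>z\<in>E. \<forall>j\<in>J. \<mu> j \<noteq> 0 \<longrightarrow> apply_bcontfun z j = (\<Sum>a<r. \<beta> (x a) z * apply_bcontfun (x a) j))"
    using weighted_gram_schmidt[of B J \<mu>, OF B(1) J \<mu>] unfolding B(2,3) \<beta>_def[abs_def] by blast
  then obtain r g where r: "r \<le> n" and gE: "\<And>a. a < r \<Longrightarrow> g a \<in> E"
    and on: "\<And>a c. a < r \<Longrightarrow> c < r \<Longrightarrow> \<beta> (g a) (g c) = (if a = c then 1 else 0)"
    and ex: "\<And>z j. z \<in> E \<Longrightarrow> j \<in> J \<Longrightarrow> \<mu> j \<noteq> 0 \<Longrightarrow>
        apply_bcontfun z j = (\<Sum>a<r. \<beta> (g a) z * apply_bcontfun (g a) j)"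
    by blast
  have vexp: "v z = (\<Sum>c<r. \<beta> (g c) z *\<^sub>R v (g c))" if z: "z \<in> E" for z
  proof -
    have "v z = (\<Sum>j\<in>J. (\<Sum>c<r. \<beta> (g c) z * apply_bcontfun (g c) j) *\<^sub>R a j)"
      unfolding v_def
    proof (rule sum.cong[OF refl])
      fix j assume j: "j \<in> J"
      show "apply_bcontfun z j *\<^sub>R a j = (\<Sum>c<r. \<beta> (g c) z * apply_bcontfun (g c) j) *\<^sub>R a j"
        using ex[OF z j] by (cases "\<mu> j = 0") (auto simp: \<mu>_def)
    qed
    also have "\<dots> = (\<Sum>j\<in>J. \<Sum>c<r. \<beta> (g c) z *\<^sub>R apply_bcontfun (g c) j *\<^sub>R a j)"
      by (simp add: scaleR_sum_left)
    also have "\<dots> = (\<Sum>c<r. \<beta> (g c) z *\<^sub>R v (g c))"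
      unfolding v_def scaleR_sum_right by (rule sum.swap)
    finally show ?thesis .
  qed
  have bexp: "\<beta> (g c) z = (\<Sum>b<n. \<beta> (g c) (x b) * apply_bcontfun z (i b))" if z: "z \<in> E" for z c
  proof -
    have zj: "apply_bcontfun z j = (\<Sum>b<n. apply_bcontfun z (i b) * apply_bcontfun (x b) j)" for j
      using arg_cong[OF expand[OF z], of "\<lambda>f. apply_bcontfun f j"] by simp
    have "\<beta> (g c) z = (\<Sum>j\<in>J. \<mu> j * apply_bcontfun (g c) j * (\<Sum>b<n. apply_bcontfun z (i b) * apply_bcontfun (x b) j))"
      unfolding \<beta>_def by (intro sum.cong refl arg_cong2[where f = "(*)"] zj)
    also have "\<dots> = (\<Sum>b<n. \<Sum>j\<in>J. \<mu> j * apply_bcontfun (g c) j * (apply_bcontfun z (i b) * apply_bcontfun (x b) j))"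
      unfolding sum_distrib_left by (rule sum.swap)
    also have "\<dots> = (\<Sum>b<n. \<beta> (g c) (x b) * apply_bcontfun z (i b))"
      unfolding \<beta>_def sum_distrib_right by (intro sum.cong refl) (simp add: ac_simps)
    finally show ?thesis .
  qed
  have "(\<Sum>b<n. apply_bcontfun (v (x b)) (i b))
      = (\<Sum>b<n. \<Sum>c<r. \<beta> (g c) (x b) * apply_bcontfun (v (g c)) (i b))"
    by (rule sum.cong[OF refl]) (use vexp[OF xE] in simp)
  also have "\<dots> = (\<Sum>c<r. \<Sum>b<n. \<beta> (g c) (x b) * apply_bcontfun (v (g c)) (i b))" by (rule sum.swap)
  also have "\<dots> = (\<Sum>c<r. \<beta> (g c) (v (g c)))"
    by (rule sum.cong[OF refl]) (use bexp[OF vE[OF gE]] in simp)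
  also have "\<dots> = (\<Sum>c<r. \<Sum>l\<in>J. \<Sum>k\<in>J. \<mu> l * apply_bcontfun (a k) l * (apply_bcontfun (g c) l * apply_bcontfun (g c) k))"
    unfolding \<beta>_def v_def
    by (intro sum.cong refl) (simp add: sum_distrib_left ac_simps)
  also have "\<dots> = (\<Sum>l\<in>J. \<Sum>c<r. \<Sum>k\<in>J. \<mu> l * apply_bcontfun (a k) l * (apply_bcontfun (g c) l * apply_bcontfun (g c) k))"
    by (rule sum.swap)
  also have "\<dots> = (\<Sum>l\<in>J. \<Sum>k\<in>J. \<Sum>c<r. \<mu> l * apply_bcontfun (a k) l * (apply_bcontfun (g c) l * apply_bcontfun (g c) k))"
    by (rule sum.cong[OF refl], rule sum.swap)
  finally have tr: "(\<Sum>b<n. apply_bcontfun (v (x b)) (i b))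
     = (\<Sum>l\<in>J. \<Sum>k\<in>J. \<mu> l * apply_bcontfun (a k) l * (\<Sum>c<r. apply_bcontfun (g c) l * apply_bcontfun (g c) k))"
    by (simp only: sum_distrib_left)
  define y where "y l c = (if c < r then apply_bcontfun (g c) l else 0)" for l c
  have inner: "(\<Sum>c<r. apply_bcontfun (g c) l * apply_bcontfun (g c) k) = inner_upto n (y l) (y k)" for l k
  proof -
    have "inner_upto n (y l) (y k) = (\<Sum>c<r. y l c * y k c)"
      unfolding inner_upto_def by (rule sum.mono_neutral_right) (use r in \<open>auto simp: y_def\<close>)
    then show ?thesis by (simp add: y_def)
  qed
  have "(\<Sum>b<n. apply_bcontfun (v (x b)) (i b)) \<le> energy J n \<mu> y"
    unfolding tr energy_def inner
  proof (intro sum_mono)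
    fix l k assume "l \<in> J" "k \<in> J"
    have "\<bar>apply_bcontfun (a k) l\<bar> \<le> \<mu> k" unfolding \<mu>_def using norm_bounded[of "a k" l] by simp
    then have "\<bar>apply_bcontfun (a k) l\<bar> * \<bar>inner_upto n (y l) (y k)\<bar> \<le> \<mu> k * \<bar>inner_upto n (y l) (y k)\<bar>"
      by (rule mult_right_mono) simp
    then have "apply_bcontfun (a k) l * inner_upto n (y l) (y k) \<le> \<mu> k * \<bar>inner_upto n (y l) (y k)\<bar>"
      by (metis abs_ge_self abs_mult order_trans)
    then have "\<mu> l * (apply_bcontfun (a k) l * inner_upto n (y l) (y k)) \<le> \<mu> l * (\<mu> k * \<bar>inner_upto n (y l) (y k)\<bar>)"
      by (rule mult_left_mono) (simp add: \<mu>_def)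
    then show "\<mu> l * apply_bcontfun (a k) l * inner_upto n (y l) (y k) \<le> \<mu> l * \<mu> k * \<bar>inner_upto n (y l) (y k)\<bar>"
      by (simp add: mult.assoc)
  qed
  also have "\<dots> \<le> M * sum \<mu> J"
  proof -
    have "(\<Sum>l\<in>J. \<mu> l * y l c * y l d) = (if c = d \<and> c < r then 1 else 0)" if "c < n" "d < n" for c d
      using on[of c d] by (cases "c < r"; cases "d < r") (auto simp: y_def \<beta>_def)
    then show ?thesis using M J r \<mu> unfolding energy_bound_def by blast
  qed
  finally show ?thesis by (simp add: \<mu>_def)
qed

text \<open>  Let \<open>S\<close> be the set of finitely supported \<open>a\<close> whose operator \<open>v a\<close> maps \<open>E\<close> into \<open>E\<close>. The trace is
  dominated on \<open>S\<close> by \<open>M \<Sum>\<^sub>j \<parallel>a\<^sub>j\<parallel>\<close>; extend it to a dominated functional \<open>c\<close> and let the \<open>j\<close>-th entry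
  of \<open>P z\<close> be the value of \<open>c\<close> at the sequence with the single entry \<open>z\<close> at \<open>j\<close>. Domination bounds each
  entry by \<open>M \<parallel>z\<parallel>\<close>. For \<open>z \<in> E\<close> that sequence is the rank-one operator \<open>w \<mapsto> w\<^sub>j z\<close>, with trace
  \<open>z\<^sub>j\<close>, so \<open>P\<close> fixes \<open>E\<close>.\<close>

lemma projection_from_energy_bound:
  assumes M0: "0 \<le> M" and M: "energy_bound n M" and E: "subspace_of_dim n E"
  shows "\<exists>P. projection_onto E P \<and> onorm P \<le> M"
proof -
  obtain x i where piv: "pivot_basis n E x i" using pivot_basis_exists[OF E] by blast
  have subE: "subspace E" using E by (simp add: subspace_of_dim_def)
  have xE: "x b \<in> E" if "b < n" for b using piv that by (auto simp: pivot_basis_def)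
  have expand: "z = (\<Sum>b<n. apply_bcontfun z (i b) *\<^sub>R x b)" if "z \<in> E" for z
    using piv that by (auto simp: pivot_basis_def)
  define supp where "supp a = {j. apply_bcontfun a j \<noteq> 0}" for a :: "nat \<Rightarrow>\<^sub>C linf"
  define W where "W = {a. finite (supp a)}"
  define nrm where "nrm a = (\<Sum>j\<in>supp a. norm (apply_bcontfun a j))" for a
  define v where "v a z = (\<Sum>j\<in>supp a. apply_bcontfun z j *\<^sub>R apply_bcontfun a j)" for a and z :: linf
  define S where "S = {a\<in>W. \<forall>z\<in>E. v a z \<in> E}"
  define t where "t a = (\<Sum>b<n. apply_bcontfun (v a (x b)) (i b))" for a
  have nrmJ: "nrm a = (\<Sum>j\<in>J. norm (apply_bcontfun a j))" if "finite J" "supp a \<subseteq> J" for a J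
    unfolding nrm_def by (rule sum.mono_neutral_left) (use that in \<open>auto simp: supp_def\<close>)
  have vJ: "v a z = (\<Sum>j\<in>J. apply_bcontfun z j *\<^sub>R apply_bcontfun a j)" if "finite J" "supp a \<subseteq> J" for a J z
    unfolding v_def by (rule sum.mono_neutral_left) (use that in \<open>auto simp: supp_def\<close>)
  have supp_add: "supp (a + b) \<subseteq> supp a \<union> supp b" for a b by (auto simp: supp_def)
  have supp_scale: "supp (c *\<^sub>R a) \<subseteq> supp a" for a c by (auto simp: supp_def)
  have supp_0: "supp 0 = {}" by (simp add: supp_def)
  have W: "subspace W"
    unfolding subspace_def W_def
  proof (intro conjI ballI allI)
    show "0 \<in> {a. finite (supp a)}" by (simp add: supp_0)
  next
    fix a b assume "a \<in> {a. finite (supp a)}" "b \<in> {a. finite (supp a)}"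
    then show "a + b \<in> {a. finite (supp a)}" using finite_subset[OF supp_add, of a b] by simp
  next
    fix c a assume "a \<in> {a. finite (supp a)}"
    then show "c *\<^sub>R a \<in> {a. finite (supp a)}" using finite_subset[OF supp_scale, of a c] by simp
  qed
  have v_add: "v (a + b) z = v a z + v b z" if "a \<in> W" "b \<in> W" for a b z
  proof -
    have f: "finite (supp a \<union> supp b)" using that by (simp add: W_def)
    show ?thesis
      by (simp add: vJ[OF f supp_add] vJ[OF f Un_upper1] vJ[OF f Un_upper2] scaleR_add_right sum.distrib)
  qed
  have v_scale: "v (c *\<^sub>R a) z = c *\<^sub>R v a z" if "a \<in> W" for a c z
  proof -
    have f: "finite (supp a)" using that by (simp add: W_def)
    show ?thesis
      by (simp add: vJ[OF f supp_scale] vJ[OF f subset_refl] scaleR_sum_right mult.commute)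
  qed
  have v_0: "v 0 z = 0" for z by (simp add: v_def supp_0)
  have S: "subspace S"
    unfolding subspace_def S_def
    using W subE v_add v_scale v_0
    by (auto intro: subspace_add subspace_scale subspace_0)
  define p where "p a = M * nrm a" for a
  have p_add: "p (a + b) \<le> p a + p b" if "a \<in> W" "b \<in> W" for a b
  proof -
    have f: "finite (supp a \<union> supp b)" using that by (simp add: W_def)
    have "nrm (a + b) \<le> nrm a + nrm b"
      unfolding nrmJ[OF f supp_add] nrmJ[OF f Un_upper1] nrmJ[OF f Un_upper2] sum.distrib[symmetric]
      by (rule sum_mono) (simp add: norm_triangle_ineq)
    then show ?thesis using M0 by (simp add: p_def mult_left_mono flip: distrib_left)
  qed
  have p_scale: "p (c *\<^sub>R a) = c * p a" if "a \<in> W" "0 \<le> c" for a c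
  proof -
    have f: "finite (supp a)" using that by (simp add: W_def)
    show ?thesis using that(2)
      by (simp add: p_def nrmJ[OF f supp_scale] nrmJ[OF f subset_refl] sum_distrib_left[symmetric])
  qed
  have t: "linear_on_subspace S t"
    unfolding linear_on_subspace_def t_def
    by (auto simp: S_def v_add v_scale sum.distrib sum_distrib_left)
  have tp: "t a \<le> p a" if "a \<in> S" for a
    unfolding t_def p_def nrm_def
    by (rule trace_bound[OF M E piv _ v_def]) (use that in \<open>auto simp: S_def W_def\<close>)
  have SW: "S \<subseteq> W" by (auto simp: S_def)
  obtain c where c: "linear_on_subspace W c" and ct: "\<And>a. a \<in> S \<Longrightarrow> c a = t a"
    and cp: "\<And>a. a \<in> W \<Longrightarrow> c a \<le> p a"
    using hahn_banach[OF W S SW p_add p_scale t tp] by blast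
  have c_add: "c (a + b) = c a + c b" if "a \<in> W" "b \<in> W" for a b
    using c that by (auto simp: linear_on_subspace_def)
  have c_scale: "c (r *\<^sub>R a) = r * c a" if "a \<in> W" for a r
    using c that by (auto simp: linear_on_subspace_def)
  have supp_single: "supp (single j z) \<subseteq> {j}" for j and z :: linf by (auto simp: supp_def)
  have sW: "single j z \<in> W" for j and z :: linf
    using finite_subset[OF supp_single[of j z]] by (simp add: W_def)
  have v_single: "v (single j z) w = apply_bcontfun w j *\<^sub>R z" for j z w
    using vJ[OF _ supp_single] by simp
  have nrm_single: "nrm (single j z) = norm z" for j z
    using nrmJ[OF _ supp_single] by simp
  have single_add: "single j (y + z) = single j y + single j z" for j and y z :: linf
    by (rule bcontfun_eqI) simp
  have single_scale: "single j (r *\<^sub>R z) = r *\<^sub>R single j z" for j r and z :: linf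
    by (rule bcontfun_eqI) simp
  have cs_add: "c (single j (y + z)) = c (single j y) + c (single j z)" for j y z
    by (simp add: single_add c_add sW)
  have cs_scale: "c (single j (r *\<^sub>R z)) = r * c (single j z)" for j r z
    by (simp add: single_scale c_scale sW)
  have cs_bound: "\<bar>c (single j z)\<bar> \<le> M * norm z" for j z
  proof -
    have le: "c (single j z) \<le> M * norm z" for z
      using cp[OF sW] by (simp add: p_def nrm_single)
    show ?thesis using le[of z] le[of "(-1) *\<^sub>R z", unfolded cs_scale] by simp
  qed
  define P where "P z = Bcontfun (\<lambda>j. c (single j z))" for z
  have Pj: "apply_bcontfun (P z) j = c (single j z)" for z j
    unfolding P_def by (subst apply_Bcontfun_bounded[where B = "M * norm z"]) (use cs_bound in auto)
  have Pnorm: "norm (P z) \<le> norm z * M" for z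
    by (rule norm_bound) (use cs_bound in \<open>simp add: Pj mult.commute\<close>)
  have bl: "bounded_linear P"
    by (rule bounded_linear_intro[where K = M])
       (auto intro!: bcontfun_eqI simp: Pj cs_add cs_scale Pnorm)
  have PE: "P z \<in> E" for z
  proof -
    have "P z = (\<Sum>b<n. apply_bcontfun (P z) (i b) *\<^sub>R x b)"
    proof (rule bcontfun_eqI)
      fix j
      \<comment> \<open>the operator of \<open>a\<close> is \<open>0\<close> on \<open>E\<close> because the pivot entries determine the \<open>j\<close>-th one; hence \<open>c a = 0\<close>\<close>
      define a where "a = single j z + (\<Sum>b<n. (- apply_bcontfun (x b) j) *\<^sub>R single (i b) z)"
      have sumW: "(\<Sum>b<m. f b *\<^sub>R single (i b) z) \<in> W" for f and m :: nat
        using W sW by (intro subspace_sum subspace_scale) auto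
      have sumv: "v (\<Sum>b<m. f b *\<^sub>R single (i b) z) w = (\<Sum>b<m. (f b * apply_bcontfun w (i b)) *\<^sub>R z)" for f w and m :: nat
        by (induction m) (use W in \<open>simp_all add: v_0 v_add v_scale sumW sW subspace_scale v_single\<close>)
      have sumc: "c (\<Sum>b<m. f b *\<^sub>R single (i b) z) = (\<Sum>b<m. f b * c (single (i b) z))" for f and m :: nat
      proof (induction m)
        case 0
        show ?case using c_scale[of 0 0] subspace_0[OF W] by simp
      next
        case (Suc m)
        then show ?case using W by (simp add: c_add c_scale sumW sW subspace_scale)
      qed
      have va: "v a w = 0" if "w \<in> E" for w
      proof -
        have "apply_bcontfun w j = (\<Sum>b<n. apply_bcontfun w (i b) * apply_bcontfun (x b) j)"
          using arg_cong[OF expand[OF that], of "\<lambda>f. apply_bcontfun f j"] by simp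
        then show ?thesis
          unfolding a_def
          by (subst v_add[OF sW sumW], subst sumv)
             (simp add: v_single mult.commute sum_negf flip: scaleR_sum_left)
      qed
      have "a \<in> W" unfolding a_def by (rule subspace_add[OF W sW sumW])
      then have "a \<in> S" using va subspace_0[OF subE] by (simp add: S_def)
      moreover have "t a = 0" using va[OF xE] by (simp add: t_def)
      ultimately have "c a = 0" using ct by simp
      then have "c (single j z) = (\<Sum>b<n. apply_bcontfun (x b) j * c (single (i b) z))"
        unfolding a_def by (simp only: c_add[OF sW sumW] sumc) (simp add: sum_negf)
      then show "apply_bcontfun (P z) j = apply_bcontfun (\<Sum>b<n. apply_bcontfun (P z) (i b) *\<^sub>R x b) j"
        by (simp add: Pj mult.commute)
    qed
    moreover have "(\<Sum>b<n. f b *\<^sub>R x b) \<in> E" for f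
      using subE xE by (auto intro!: subspace_sum subspace_scale)
    ultimately show ?thesis by metis
  qed
  have Pid: "P w = w" if w: "w \<in> E" for w
  proof (rule bcontfun_eqI)
    fix j
    have "single j w \<in> S" using w subE sW by (auto simp: S_def v_single subspace_scale)
    then have "apply_bcontfun (P w) j = (\<Sum>b<n. apply_bcontfun (x b) j * apply_bcontfun w (i b))"
      by (simp add: Pj ct t_def v_single)
    also have "\<dots> = apply_bcontfun w j"
      using arg_cong[OF expand[OF w], of "\<lambda>f. apply_bcontfun f j"] by (simp add: mult.commute)
    finally show "apply_bcontfun (P w) j = apply_bcontfun w j" .
  qed
  have "range P = E" using PE Pid by (metis image_subset_iff rangeI subsetI subset_antisym)
  moreover have "P \<circ> P = P" using PE Pid by auto
  ultimately have "projection_onto E P" using bl by (simp add: projection_onto_def)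
  moreover have "onorm P \<le> M"
    by (rule onorm_bound[OF M0]) (use Pnorm in \<open>simp add: mult.commute\<close>)
  ultimately show ?thesis by blast
qed

section \<open>Isometric embeddings of finite-dimensional spaces\<close>

lemma norming_functional:
  assumes V: "subspace V" and N: "norm_on V N" and q: "q \<in> V"
  shows "\<exists>f. linear_on_subspace V f \<and> f q = N q \<and> (\<forall>x\<in>V. f x \<le> N x)"
proof (cases "q = 0")
  case True
  then show ?thesis using N V by (intro exI[of _ "\<lambda>_. 0"]) (auto simp: linear_on_subspace_def norm_on_def subspace_0)
next
  case False
  have nn: "0 \<le> N x" if "x \<in> V" for x using N that by (auto simp: norm_on_def)
  have scale: "N (c *\<^sub>R x) = \<bar>c\<bar> * N x" if "x \<in> V" for c x using N that by (auto simp: norm_on_def)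
  have tri: "N (x + y) \<le> N x + N y" if "x \<in> V" "y \<in> V" for x y using N that by (auto simp: norm_on_def)
  have "independent {q}" using False by simp
  from linear_independent_extend[OF this, of "\<lambda>_. N q"]
  obtain f0 :: "'a \<Rightarrow> real" where f0: "linear f0" "f0 q = N q" by auto
  have S: "span {q} \<subseteq> V" using q V by (simp add: span_minimal)
  have le: "f0 x \<le> N x" if x: "x \<in> span {q}" for x
  proof -
    obtain k where k: "x = k *\<^sub>R q" using x by (auto simp: span_singleton)
    have "k * N q \<le> \<bar>k\<bar> * N q" by (rule mult_right_mono[OF abs_ge_self nn[OF q]])
    then show ?thesis using f0 by (simp add: k linear_scale scale[OF q])
  qed
  have pos: "N (c *\<^sub>R x) = c * N x" if "x \<in> V" "0 \<le> c" for x c using scale that by simp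
  obtain f where "linear_on_subspace V f" "\<And>x. x \<in> span {q} \<Longrightarrow> f x = f0 x" "\<And>x. x \<in> V \<Longrightarrow> f x \<le> N x"
    using hahn_banach[OF V subspace_span S tri pos linear_imp_linear_on_subspace[OF f0(1)] le] by blast
  moreover have "q \<in> span {q}" by (simp add: span_base)
  ultimately show ?thesis using f0(2) by (intro exI[of _ f]) auto
qed

text \<open>  A norming functional is chosen for each combination of basis vectors with rational coefficients.
  Such combinations are countable and dense, so the values of these functionals form a sequence
  whose supremum is the norm.\<close>

lemma isometric_embedding_exists:
  fixes V :: "'a::real_vector set"
  assumes "banach_of_dim n V N"
  shows "\<exists>T. isometric_embedding V N T"
proof -
  have sd: "subspace_of_dim n V" and N: "norm_on V N" using assms by (auto simp: banach_of_dim_def)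
  have V: "subspace V" using sd by (simp add: subspace_of_dim_def)
  obtain B where B: "finite B" "independent B" "span B = V" "card B = n"
    by (rule subspace_of_dim_basis[OF sd])
  have nn: "0 \<le> N x" if "x \<in> V" for x using N that by (auto simp: norm_on_def)
  have scale: "N (c *\<^sub>R x) = \<bar>c\<bar> * N x" if "x \<in> V" for c x using N that by (auto simp: norm_on_def)
  have tri: "N (x + y) \<le> N x + N y" if "x \<in> V" "y \<in> V" for x y using N that by (auto simp: norm_on_def)
  have BV: "B \<subseteq> V" using B(3) span_superset by blast
  have comb: "(\<Sum>b\<in>C. r b *\<^sub>R b) \<in> V \<and> N (\<Sum>b\<in>C. r b *\<^sub>R b) \<le> (\<Sum>b\<in>C. \<bar>r b\<bar> * N b)"
    if "finite C" "C \<subseteq> V" for C and r :: "'a \<Rightarrow> real"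
    using that
  proof (induction C rule: finite_induct)
    case empty
    have "N 0 = 0" using N subspace_0[OF V] by (auto simp: norm_on_def)
    then show ?case using subspace_0[OF V] by simp
  next
    case (insert b C)
    then have b: "b \<in> V" and IH: "(\<Sum>b\<in>C. r b *\<^sub>R b) \<in> V" "N (\<Sum>b\<in>C. r b *\<^sub>R b) \<le> (\<Sum>b\<in>C. \<bar>r b\<bar> * N b)"
      by auto
    have "r b *\<^sub>R b \<in> V" by (rule subspace_scale[OF V b])
    then show ?case using insert.hyps IH tri[of "r b *\<^sub>R b" "\<Sum>b\<in>C. r b *\<^sub>R b"] scale[OF b, of "r b"]
      by (auto intro: subspace_add[OF V])
  qed
  define \<D> where "\<D> = (\<lambda>r. \<Sum>b\<in>B. r b *\<^sub>R b) ` (B \<rightarrow>\<^sub>E \<rat>)"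
  have "countable (B \<rightarrow>\<^sub>E (\<rat> :: real set))" by (intro countable_PiE B(1) countable_rat)
  then have cD: "countable \<D>" by (simp add: \<D>_def)
  have "(\<lambda>b\<in>B. 0) \<in> B \<rightarrow>\<^sub>E (\<rat> :: real set)" by auto
  then have D0: "\<D> \<noteq> {}" unfolding \<D>_def by blast
  have DV: "\<D> \<subseteq> V" using comb[OF B(1) BV] by (auto simp: \<D>_def)
  define q where "q = from_nat_into \<D>"
  have rq: "range q = \<D>" using cD D0 by (simp add: q_def)
  have qV: "q k \<in> V" for k using rq DV by blast
  have "\<forall>k. \<exists>f. linear_on_subspace V f \<and> f (q k) = N (q k) \<and> (\<forall>x\<in>V. f x \<le> N x)"
    using norming_functional[OF V N qV] by blast
  from choice[OF this] obtain f where f: "\<And>k. linear_on_subspace V (f k)" "\<And>k. f k (q k) = N (q k)"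
    "\<And>k x. x \<in> V \<Longrightarrow> f k x \<le> N x" by blast
  have fadd: "f k (x + y) = f k x + f k y" if "x \<in> V" "y \<in> V" for k x y
    using f(1)[of k] that by (auto simp: linear_on_subspace_def)
  have fscale: "f k (c *\<^sub>R x) = c * f k x" if "x \<in> V" for k x c
    using f(1)[of k] that by (auto simp: linear_on_subspace_def)
  have fb: "\<bar>f k x\<bar> \<le> N x" if x: "x \<in> V" for k x
  proof -
    have "f k ((-1) *\<^sub>R x) \<le> N ((-1) *\<^sub>R x)" by (rule f(3)[OF subspace_scale[OF V x]])
    then have "- f k x \<le> N x" unfolding fscale[OF x] scale[OF x] by simp
    then show ?thesis using f(3)[OF x, of k] by simp
  qed
  obtain T :: "'a \<Rightarrow> linf" where T: "linear T" "\<And>b. b \<in> B \<Longrightarrow> T b = Bcontfun (\<lambda>k. f k b)"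
    using linear_independent_extend[OF B(2), of "\<lambda>b. Bcontfun (\<lambda>k. f k b)"] by blast
  have TB: "apply_bcontfun (T b) k = f k b" if b: "b \<in> B" for b k
    unfolding T(2)[OF b]
    by (subst apply_Bcontfun_bounded[where B = "N b"]) (use fb b BV in auto)
  have TV: "apply_bcontfun (T x) k = f k x" if x: "x \<in> V" for x k
  proof -
    have "x \<in> {x\<in>V. apply_bcontfun (T x) k = f k x}"
    proof (rule span_induct[of x B "\<lambda>x. x \<in> {x\<in>V. apply_bcontfun (T x) k = f k x}"])
      show "x \<in> span B" using x B(3) by simp
      show "subspace {x. x \<in> {x\<in>V. apply_bcontfun (T x) k = f k x}}"
        unfolding subspace_def
        using V T(1) fadd fscale[of 0 k 0] fscale
        by (auto simp: linear_0 linear_add linear_scale intro: subspace_0 subspace_add subspace_scale)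
      show "b \<in> {x\<in>V. apply_bcontfun (T x) k = f k x}" if "b \<in> B" for b
        using that BV TB by auto
    qed
    then show ?thesis by simp
  qed
  have "norm (T x) = N x" if x: "x \<in> V" for x
  proof (rule antisym)
    show "norm (T x) \<le> N x" by (rule norm_bound) (simp add: TV[OF x] fb[OF x])
    show "N x \<le> norm (T x)"
    proof (rule field_le_epsilon)
      fix e :: real assume e: "0 < e"
      define M where "M = (\<Sum>b\<in>B. N b)"
      have M0: "0 \<le> M" unfolding M_def using nn BV by (intro sum_nonneg) auto
      define \<delta> where "\<delta> = e / 2 / (M + 1)"
      have \<delta>: "0 < \<delta>" using e M0 by (simp add: \<delta>_def)
      obtain c where c: "x = (\<Sum>b\<in>B. c b *\<^sub>R b)"
        using x B(3) span_finite[OF B(1)] by auto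
      have "\<exists>r\<in>\<rat>. \<bar>c b - r\<bar> < \<delta>" for b
      proof -
        obtain r where "r \<in> \<rat>" "c b < r" "r < c b + \<delta>" using Rats_dense_in_real[of "c b" "c b + \<delta>"] \<delta> by auto
        then show ?thesis by (intro bexI[of _ r]) auto
      qed
      then obtain r where r: "\<And>b. r b \<in> \<rat>" "\<And>b. \<bar>c b - r b\<bar> < \<delta>" by metis
      have "(\<Sum>b\<in>B. r b *\<^sub>R b) = (\<Sum>b\<in>B. restrict r B b *\<^sub>R b)" by (rule sum.cong) auto
      moreover have "restrict r B \<in> B \<rightarrow>\<^sub>E \<rat>" using r(1) by auto
      ultimately have "(\<Sum>b\<in>B. r b *\<^sub>R b) \<in> \<D>" unfolding \<D>_def by blast
      then obtain k where k: "q k = (\<Sum>b\<in>B. r b *\<^sub>R b)" using rq by (metis imageE)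
      have diff: "x - q k = (\<Sum>b\<in>B. (c b - r b) *\<^sub>R b)"
        by (simp add: c k scaleR_diff_left sum_subtractf)
      have "N (x - q k) \<le> (\<Sum>b\<in>B. \<bar>c b - r b\<bar> * N b)" unfolding diff using comb[OF B(1) BV, of "\<lambda>b. c b - r b"] by simp
      also have "\<dots> \<le> (\<Sum>b\<in>B. \<delta> * N b)"
        by (intro sum_mono mult_right_mono) (use r(2) nn BV in \<open>auto intro: less_imp_le\<close>)
      also have "\<dots> = \<delta> * M" by (simp add: M_def sum_distrib_left)
      also have "\<dots> \<le> \<delta> * (M + 1)" using \<delta> by simp
      also have "\<dots> = e / 2"
      proof -
        have "M + 1 \<noteq> 0" using M0 by linarith
        from nonzero_eq_divide_eq[OF this, THEN iffD1, OF \<delta>_def] show ?thesis .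
      qed
      finally have small: "N (x - q k) \<le> e / 2" .
      have dV: "x - q k \<in> V" by (rule subspace_diff[OF V x qV])
      have "N x \<le> N (q k) + N (x - q k)" using tri[OF qV[of k] dV] by simp
      moreover have "f k x = f k (q k) + f k (x - q k)" using fadd[OF qV[of k] dV, of k] by simp
      moreover have "\<bar>f k (x - q k)\<bar> \<le> N (x - q k)" by (rule fb[OF dV])
      moreover have "f k x \<le> norm (T x)" using norm_bounded[of "T x" k] TV[OF x, of k] by simp
      ultimately show "N x \<le> norm (T x) + e" using small f(2)[of k] by linarith
    qed
  qed
  then show ?thesis using T(1) by (auto simp: isometric_embedding_def)
qed

lemma subspace_of_dim_image:
  assumes V: "subspace_of_dim n V" and T: "linear T" "inj_on T V"
  shows "subspace_of_dim n (T ` V)"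
proof -
  obtain B where B: "finite B" "independent B" "span B = V" "card B = n"
    using subspace_of_dim_basis[OF V] by blast
  have inj: "inj_on T B" using T(2) B(3) span_superset by (metis inj_on_subset)
  show ?thesis
  proof (rule subspace_of_dimI)
    show "finite (T ` B)" using B by simp
    show "independent (T ` B)"
      using linear_independent_injective_image[OF T(1) B(2)] T(2) B(3) by simp
    show "span (T ` B) = T ` V" using linear_span_image[OF T(1), of B] B(3) by simp
    show "card (T ` B) = n" using card_image[OF inj] B(4) by simp
  qed
qed

lemma isometric_embedding_inj_on:
  assumes "banach_of_dim n V N" "isometric_embedding V N T"
  shows "inj_on T V"
proof (rule inj_onI)
  fix x y assume xy: "x \<in> V" "y \<in> V" "T x = T y"
  have V: "subspace V" using assms by (simp add: banach_of_dim_def subspace_of_dim_def)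
  have d: "x - y \<in> V" by (rule subspace_diff[OF V xy(1,2)])
  have "T (x - y) = 0" using assms(2) xy(3) by (simp add: isometric_embedding_def linear_diff)
  then have "N (x - y) = 0" using assms(2) d by (metis isometric_embedding_def norm_zero)
  then show "x = y" using assms(1) d by (auto simp: banach_of_dim_def norm_on_def)
qed

lemma proj_const_le_energy_bound:
  assumes "0 \<le> M" "energy_bound n M" "banach_of_dim n V N"
  shows "proj_const V N \<le> ereal M"
proof -
  define T where "T = (SOME T. isometric_embedding V N T)"
  have T: "isometric_embedding V N T"
    unfolding T_def using isometric_embedding_exists[OF assms(3)] by (rule someI_ex)
  have "subspace_of_dim n (T ` V)"
    using subspace_of_dim_image isometric_embedding_inj_on[OF assms(3) T] T assms(3)
    by (auto simp: banach_of_dim_def isometric_embedding_def)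
  then obtain P where P: "projection_onto (T ` V) P" "onorm P \<le> M"
    using projection_from_energy_bound[OF assms(1,2)] by blast
  have "embedded_proj_const (T ` V) \<le> ereal (onorm P)"
    unfolding embedded_proj_const_def by (rule INF_lower) (use P in simp)
  also have "\<dots> \<le> ereal M" using P by simp
  finally show ?thesis by (simp add: proj_const_def T_def)
qed

section \<open>Frames of maximal energy\<close>

text \<open>  The energy in the variables \<open>s\<^sub>l = \<surd>w\<^sub>l\<close> and \<open>g\<^sub>l = s\<^sub>l y\<^sub>l\<close>. The constraints confine these to a compact
  set, whereas \<open>y\<^sub>l\<close> may be unbounded when \<open>w\<^sub>l\<close> tends to \<open>0\<close>.\<close>

definition frame_energy :: "nat \<Rightarrow> nat \<Rightarrow> (nat \<Rightarrow> real) \<Rightarrow> (nat \<Rightarrow> nat \<Rightarrow> real) \<Rightarrow> real" where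
  "frame_energy D n s g = (\<Sum>l<D. \<Sum>k<D. s l * s k * \<bar>inner_upto n (g l) (g k)\<bar>)"

definition orthonormal_columns :: "nat \<Rightarrow> nat \<Rightarrow> (nat \<Rightarrow> nat \<Rightarrow> real) \<Rightarrow> bool" where
  "orthonormal_columns D n g \<longleftrightarrow>
     (\<forall>a<n. \<forall>b<n. (\<Sum>l<D. g l a * g l b) = (if a = b then 1 else 0))"

definition unit_weights :: "nat \<Rightarrow> (nat \<Rightarrow> real) \<Rightarrow> bool" where
  "unit_weights D s \<longleftrightarrow> (\<forall>l<D. 0 \<le> s l) \<and> (\<Sum>l<D. s l * s l) = 1"

lemma compact_function_space:
  fixes C :: "'b::topological_space set"
  assumes "compact C"
  shows "compact {f :: 'a \<Rightarrow> 'b. \<forall>i. f i \<in> C}"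
proof -
  have "compactin (product_topology (\<lambda>_. euclidean) UNIV) (PiE UNIV (\<lambda>_::'a. C))"
    using assms by (simp add: compactin_PiE)
  moreover have "PiE UNIV (\<lambda>_::'a. C) = {f. \<forall>i. f i \<in> C}" by auto
  ultimately show ?thesis by (simp add: euclidean_product_topology)
qed

lemma frame_energy_attains_max:
  assumes "1 \<le> D" "n \<le> D"
  obtains s g where "unit_weights D s" "orthonormal_columns D n g"
    "\<And>s' g'. unit_weights D s' \<Longrightarrow> orthonormal_columns D n g' \<Longrightarrow> frame_energy D n s' g' \<le> frame_energy D n s g"
proof -
  define box where "box = {s :: nat \<Rightarrow> real. \<forall>l. s l \<in> {-1..1}} \<times> {g :: nat \<Rightarrow> nat \<Rightarrow> real. \<forall>l. g l \<in> {h. \<forall>a. h a \<in> {-1..1}}}"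
  have "compact box" unfolding box_def
    by (intro compact_Times compact_function_space compact_Icc)
  define Z :: "((nat \<Rightarrow> real) \<times> (nat \<Rightarrow> nat \<Rightarrow> real)) set" where
    "Z = {p. \<forall>l\<in>{..<D}. 0 \<le> fst p l} \<inter> {p. (\<Sum>l<D. fst p l * fst p l) = 1}
        \<inter> {p. \<forall>a\<in>{..<n}. \<forall>b\<in>{..<n}. (\<Sum>l<D. snd p l a * snd p l b) = (if a = b then 1 else 0)}"
  have cg: "continuous_on UNIV (\<lambda>p :: (nat \<Rightarrow> real) \<times> (nat \<Rightarrow> nat \<Rightarrow> real). snd p l a)" for l a
    by (rule continuous_on_product_then_coordinatewise, rule continuous_on_product_then_coordinatewise)
       (intro continuous_intros)
  have cs: "continuous_on UNIV (\<lambda>p :: (nat \<Rightarrow> real) \<times> (nat \<Rightarrow> nat \<Rightarrow> real). fst p l)" for l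
    by (rule continuous_on_product_then_coordinatewise) (intro continuous_intros)
  have "closed Z" unfolding Z_def Ball_def
    by (intro closed_Int closed_Collect_all closed_Collect_imp open_Collect_const closed_Collect_eq
        closed_Collect_le continuous_intros cs cg)
  then have K: "compact (box \<inter> Z)" by (rule compact_Int_closed[OF \<open>compact box\<close>])
  \<comment> \<open>entries beyond the first \<open>D\<close> rows and \<open>n\<close> columns are unconstrained; they are set to \<open>0\<close> to stay in the box\<close>
  have mem: "(\<lambda>l. if l < D then s l else 0, \<lambda>l a. if l < D \<and> a < n then g l a else 0) \<in> box \<inter> Z"
    if s: "unit_weights D s" and g: "orthonormal_columns D n g" for s g
  proof -
    have "\<bar>s l\<bar> \<le> 1" if "l < D" for l
    proof -
      have "s l * s l \<le> (\<Sum>l<D. s l * s l)" using that by (intro member_le_sum) auto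
      then have "(s l)\<^sup>2 \<le> 1" using s by (simp add: unit_weights_def power2_eq_square)
      then show ?thesis by (simp add: abs_square_le_1)
    qed
    moreover have "\<bar>g l a\<bar> \<le> 1" if "l < D" "a < n" for l a
    proof -
      have "g l a * g l a \<le> (\<Sum>l<D. g l a * g l a)" using that by (intro member_le_sum) auto
      then have "(g l a)\<^sup>2 \<le> 1" using g that by (simp add: orthonormal_columns_def power2_eq_square)
      then show ?thesis by (simp add: abs_square_le_1)
    qed
    moreover have "(\<Sum>l<D. (if l < D then e l else 0) * (if l < D then f l else 0)) = (\<Sum>l<D. e l * f l)"
      for e f :: "nat \<Rightarrow> real" by (rule sum.cong) auto
    ultimately show ?thesis using s g
      by (auto simp: box_def Z_def unit_weights_def orthonormal_columns_def abs_le_iff minus_le_iff)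
  qed
  have "unit_weights D (\<lambda>l. if l = 0 then 1 else 0)"
    using assms by (auto simp: unit_weights_def mult_delta_left)
  moreover have "orthonormal_columns D n (\<lambda>l a. if l = a then 1 else 0)"
    using assms by (auto simp: orthonormal_columns_def mult_delta_left)
  ultimately have ne: "box \<inter> Z \<noteq> {}" using mem by blast
  have "continuous_on (box \<inter> Z) (\<lambda>p. frame_energy D n (fst p) (snd p))"
    unfolding frame_energy_def inner_upto_def
    by (intro continuous_intros continuous_on_subset[OF cs] continuous_on_subset[OF cg]) auto
  from continuous_attains_sup[OF K ne this] obtain p where p: "p \<in> box \<inter> Z"
    and max: "\<And>q. q \<in> box \<inter> Z \<Longrightarrow> frame_energy D n (fst q) (snd q) \<le> frame_energy D n (fst p) (snd p)"
    by blast
  show thesis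
  proof (rule that[of "fst p" "snd p"])
    show "unit_weights D (fst p)" using p by (auto simp: Z_def unit_weights_def)
    show "orthonormal_columns D n (snd p)" using p by (auto simp: Z_def orthonormal_columns_def)
    fix s' g' assume sg: "unit_weights D s'" "orthonormal_columns D n g'"
    have "frame_energy D n s' g' = frame_energy D n (\<lambda>l. if l < D then s' l else 0)
        (\<lambda>l a. if l < D \<and> a < n then g' l a else 0)"
      unfolding frame_energy_def inner_upto_def by (intro sum.cong refl) auto
    then show "frame_energy D n s' g' \<le> frame_energy D n (fst p) (snd p)"
      using max[OF mem[OF sg]] by simp
  qed
qed

text \<open>  After the reduction of the support, at most \<open>support_bound n\<close> points remain. The other \<open>n\<close>
  positions are reserved for points of weight \<open>0\<close>, which complete the columns that vanish when
  \<open>r < n\<close> to an orthonormal system and do not contribute to the energy.\<close>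

lemma energy_bound_from_frames:
  assumes D: "D = support_bound n + n"
    and max: "\<And>s g. unit_weights D s \<Longrightarrow> orthonormal_columns D n g \<Longrightarrow> frame_energy D n s g \<le> M"
  shows "energy_bound n M"
  unfolding energy_bound_def
proof (intro allI impI)
  fix J :: "nat set" and w :: "nat \<Rightarrow> real" and y :: "nat \<Rightarrow> nat \<Rightarrow> real" and r
  assume J: "finite J" and w: "\<forall>l\<in>J. 0 \<le> w l" and r: "r \<le> n"
    and mom: "\<forall>a<n. \<forall>b<n. (\<Sum>l\<in>J. w l * y l a * y l b) = (if a = b \<and> a < r then 1 else 0)"
  show "energy J n w y \<le> M * sum w J"
  proof (cases "sum w J = 0")
    case True
    then have "\<forall>l\<in>J. w l = 0" using sum_nonneg_eq_0_iff[OF J] w by blast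
    then show ?thesis using True by (simp add: energy_def)
  next
    case False
    define \<sigma> where "\<sigma> = sum w J"
    have \<sigma>: "\<sigma> > 0" using False w sum_nonneg[of J w] by (simp add: \<sigma>_def)
    obtain u where u: "\<forall>l\<in>J. 0 \<le> u l" and us: "sum u J = \<sigma>"
      and umom: "\<forall>a<n. \<forall>b<n. (\<Sum>l\<in>J. u l * y l a * y l b) = (\<Sum>l\<in>J. w l * y l a * y l b)"
      and ue: "energy J n w y \<le> energy J n u y" and uc: "card {l\<in>J. u l \<noteq> 0} \<le> support_bound n"
      using weight_reduction[OF J, of w n y] w \<sigma>_def by blast
    define U where "U = {l\<in>J. u l \<noteq> 0}"
    define m where "m = card U"
    have U: "finite U" "U \<subseteq> J" using J by (auto simp: U_def)
    obtain h where h: "bij_betw h {..<m} U"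
      using ex_bij_betw_nat_finite[OF U(1)] by (auto simp: m_def lessThan_atLeast0)
    have m: "m \<le> support_bound n" using uc by (simp add: m_def U_def)
    have toJ: "(\<Sum>l<m. f (h l)) = sum f J" if "\<And>l. l \<in> J \<Longrightarrow> u l = 0 \<Longrightarrow> f l = 0" for f :: "nat \<Rightarrow> real"
    proof -
      have "(\<Sum>l<m. f (h l)) = sum f U" by (rule sum.reindex_bij_betw[OF h])
      also have "\<dots> = sum f J"
        by (rule sum.mono_neutral_left) (use J U that in \<open>auto simp: U_def\<close>)
      finally show ?thesis .
    qed
    have hu: "0 \<le> u (h l)" if "l < m" for l
      using bij_betwE[OF h] that u by (auto simp: U_def)
    define s where "s l = (if l < m then sqrt (u (h l)) / sqrt \<sigma> else 0)" for l
    define g where "g l a = (if l < m then sqrt (u (h l)) * y (h l) a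
        else if l = support_bound n + a \<and> r \<le> a then 1 else 0)" for l a
    have split: "sum f {..<D} = (\<Sum>l<m. f l) + (\<Sum>l\<in>{m..<D}. f l)" for f :: "nat \<Rightarrow> real"
      using sum.atLeastLessThan_concat[of 0 m D f] m D by (simp add: lessThan_atLeast0)
    have "(\<Sum>l<m. s l * s l) = (\<Sum>l<m. u (h l) / \<sigma>)"
      by (rule sum.cong) (use hu \<sigma> in \<open>auto simp: s_def\<close>)
    also have "\<dots> = (\<Sum>l<m. u (h l)) / \<sigma>" by (rule sum_divide_distrib[symmetric])
    also have "\<dots> = 1" using toJ[of u] us \<sigma> by simp
    finally have s1: "unit_weights D s"
      unfolding unit_weights_def split using hu \<sigma> by (auto simp: s_def)
    have "(\<Sum>l<D. g l a * g l b) = (if a = b then 1 else 0)" if ab: "a < n" "b < n" for a b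
    proof -
      have "(\<Sum>l<m. g l a * g l b) = (\<Sum>l<m. u (h l) * y (h l) a * y (h l) b)"
        by (rule sum.cong) (use hu in \<open>auto simp: g_def\<close>)
      also have "\<dots> = (\<Sum>l\<in>J. u l * y l a * y l b)" by (rule toJ) simp
      also have "\<dots> = (if a = b \<and> a < r then 1 else 0)" using umom mom ab by simp
      finally have 1: "(\<Sum>l<m. g l a * g l b) = (if a = b \<and> a < r then 1 else 0)" .
      have "(\<Sum>l\<in>{m..<D}. g l a * g l b) = (\<Sum>l\<in>{m..<D}. if l = support_bound n + a then (if a = b \<and> r \<le> a then 1 else 0) else 0)"
        by (rule sum.cong) (auto simp: g_def)
      also have "\<dots> = (if a = b \<and> r \<le> a then 1 else 0)" using ab m D by simp
      finally show ?thesis unfolding split 1 by auto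
    qed
    then have g1: "orthonormal_columns D n g" by (simp add: orthonormal_columns_def)
    have "frame_energy D n s g = (\<Sum>l<m. \<Sum>k<m. s l * s k * \<bar>inner_upto n (g l) (g k)\<bar>)"
      unfolding frame_energy_def split by (simp add: s_def)
    also have "\<dots> = (\<Sum>l<m. \<Sum>k<m. u (h l) * u (h k) * \<bar>inner_upto n (y (h l)) (y (h k))\<bar> / \<sigma>)"
    proof (intro sum.cong refl)
      fix l k assume "l \<in> {..<m}" "k \<in> {..<m}"
      then have lk: "l < m" "k < m" by auto
      have "inner_upto n (g l) (g k) = sqrt (u (h l)) * sqrt (u (h k)) * inner_upto n (y (h l)) (y (h k))"
        unfolding inner_upto_def sum_distrib_left using lk by (intro sum.cong) (auto simp: g_def)
      moreover have "s l * s k = sqrt (u (h l)) * sqrt (u (h k)) / \<sigma>"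
        using lk \<sigma> by (simp add: s_def)
      moreover define p where "p = sqrt (u (h l))"
      moreover define q where "q = sqrt (u (h k))"
      moreover have "0 \<le> p" "0 \<le> q" using hu lk by (auto simp: p_def q_def)
      ultimately have "s l * s k * \<bar>inner_upto n (g l) (g k)\<bar>
         = (p * q / \<sigma>) * (p * q * \<bar>inner_upto n (y (h l)) (y (h k))\<bar>)"
        by (simp add: abs_mult)
      also have "\<dots> = (p * p) * (q * q) * \<bar>inner_upto n (y (h l)) (y (h k))\<bar> / \<sigma>"
        by (simp add: ac_simps)
      also have "p * p = u (h l)" using hu lk by (auto simp: p_def)
      also have "q * q = u (h k)" using hu lk by (auto simp: q_def)
      finally show "s l * s k * \<bar>inner_upto n (g l) (g k)\<bar>
         = u (h l) * u (h k) * \<bar>inner_upto n (y (h l)) (y (h k))\<bar> / \<sigma>" .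
    qed
    also have "\<dots> = (\<Sum>l<m. \<Sum>k<m. u (h l) * u (h k) * \<bar>inner_upto n (y (h l)) (y (h k))\<bar>) / \<sigma>"
      by (simp add: sum_divide_distrib)
    also have "(\<Sum>l<m. \<Sum>k<m. u (h l) * u (h k) * \<bar>inner_upto n (y (h l)) (y (h k))\<bar>)
        = (\<Sum>l<m. \<Sum>k\<in>J. u (h l) * u k * \<bar>inner_upto n (y (h l)) (y k)\<bar>)"
      by (rule sum.cong[OF refl]) (rule toJ, simp)
    also have "\<dots> = energy J n u y" unfolding energy_def
      by (rule toJ[of "\<lambda>l. \<Sum>k\<in>J. u l * u k * \<bar>inner_upto n (y l) (y k)\<bar>"]) simp
    finally have "energy J n u y / \<sigma> \<le> M" using max[OF s1 g1] by simp
    then have "energy J n u y \<le> M * \<sigma>" using \<sigma> by (simp add: divide_le_eq)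
    then show ?thesis using ue by (simp add: \<sigma>_def)
  qed
qed

definition sign_matrix :: "nat \<Rightarrow> (nat \<Rightarrow> nat \<Rightarrow> real) \<Rightarrow> nat \<Rightarrow> nat \<Rightarrow> real" where
  "sign_matrix n g l k = sgn (inner_upto n (g l) (g k))"

text \<open>  With the signs frozen at \<open>g\<close>, the quadratic form \<open>F\<close> of the symmetric matrix \<open>B\<close> is a lower bound
  for the energy that agrees with it at \<open>g\<close>, so \<open>g\<close> also maximises \<open>F\<close>. If the image under \<open>B\<close> of a
  column of \<open>g\<close> had a component \<open>h\<close> orthogonal to all columns, then rotating that column towards \<open>h\<close>
  would increase \<open>F\<close> to first order.\<close>

lemma maximal_frame_invariant:
  fixes s :: "nat \<Rightarrow> real" and g :: "nat \<Rightarrow> nat \<Rightarrow> real" and D n :: nat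
  defines "B \<equiv> \<lambda>l k. s l * sign_matrix n g l k * s k"
  assumes s: "\<And>l. l < D \<Longrightarrow> 0 \<le> s l" and g: "orthonormal_columns D n g"
    and max: "\<And>g'. orthonormal_columns D n g' \<Longrightarrow> frame_energy D n s g' \<le> frame_energy D n s g"
  obtains V where "\<And>l b. l < D \<Longrightarrow> b < n \<Longrightarrow> (\<Sum>k<D. B l k * g k b) = (\<Sum>a<n. g l a * V a b)"
    "(\<Sum>a<n. V a a) = frame_energy D n s g"
proof -
  have on: "(\<Sum>l<D. g l a * g l b) = (if a = b then 1 else 0)" if "a < n" "b < n" for a b
    using g that by (auto simp: orthonormal_columns_def)
  have isym: "inner_upto n y z = inner_upto n z y" for y z by (simp add: inner_upto_def mult.commute)
  have Bsym: "B l k = B k l" for l k by (simp add: B_def sign_matrix_def isym[of "g l"])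
  define V where "V a b = (\<Sum>l<D. \<Sum>k<D. g l a * (B l k * g k b))" for a b
  define F where "F g' = (\<Sum>l<D. \<Sum>k<D. B l k * inner_upto n (g' l) (g' k))" for g'
  have Fle: "F g' \<le> frame_energy D n s g'" for g'
    unfolding F_def frame_energy_def
  proof (intro sum_mono)
    fix l k assume "l \<in> {..<D}" "k \<in> {..<D}"
    then have ss: "0 \<le> s l * s k" using s by simp
    have "\<bar>sign_matrix n g l k\<bar> \<le> 1" by (simp add: sign_matrix_def abs_sgn_eq)
    then have "\<bar>sign_matrix n g l k * inner_upto n (g' l) (g' k)\<bar> \<le> 1 * \<bar>inner_upto n (g' l) (g' k)\<bar>"
      unfolding abs_mult by (rule mult_right_mono) simp
    then have "sign_matrix n g l k * inner_upto n (g' l) (g' k) \<le> \<bar>inner_upto n (g' l) (g' k)\<bar>" by linarith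
    from mult_left_mono[OF this ss]
    show "B l k * inner_upto n (g' l) (g' k) \<le> s l * s k * \<bar>inner_upto n (g' l) (g' k)\<bar>"
      by (simp add: B_def ac_simps)
  qed
  have Feq: "F g = frame_energy D n s g"
    unfolding F_def frame_energy_def
    by (intro sum.cong refl) (simp add: B_def sign_matrix_def abs_sgn ac_simps)
  have Fmax: "F g' \<le> F g" if "orthonormal_columns D n g'" for g'
    using Fle[of g'] max[OF that] Feq by simp
  have inv: "(\<Sum>k<D. B l0 k * g k b) = (\<Sum>a<n. g l0 a * V a b)" if l0: "l0 < D" and b: "b < n" for l0 b
  proof -
    define h where "h l = (\<Sum>k<D. B l k * g k b) - (\<Sum>a<n. g l a * V a b)" for l
    have hg: "(\<Sum>l<D. g l c * h l) = 0" if c: "c < n" for c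
    proof -
      have "(\<Sum>l<D. g l c * (\<Sum>a<n. g l a * V a b)) = (\<Sum>l<D. \<Sum>a<n. (g l c * g l a) * V a b)"
        by (simp add: sum_distrib_left mult.assoc)
      also have "\<dots> = (\<Sum>a<n. \<Sum>l<D. (g l c * g l a) * V a b)" by (rule sum.swap)
      also have "\<dots> = (\<Sum>a<n. (if c = a then 1 else 0) * V a b)"
        by (rule sum.cong[OF refl]) (use on c in \<open>simp flip: sum_distrib_right\<close>)
      also have "\<dots> = V c b"
        using c by (simp add: if_distrib[of "\<lambda>t. t * _"] cong: if_cong)
      finally have "(\<Sum>l<D. g l c * (\<Sum>a<n. g l a * V a b)) = V c b" .
      then show ?thesis by (simp add: h_def right_diff_distrib sum_subtractf V_def sum_distrib_left)
    qed
    have "(\<Sum>l<D. h l * h l) = 0"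
    proof (rule ccontr)
      assume "\<not> ?thesis"
      moreover have "0 \<le> (\<Sum>l<D. h l * h l)" by (simp add: sum_nonneg)
      ultimately have pos: "0 < (\<Sum>l<D. h l * h l)" by simp
      define \<nu> where "\<nu> = sqrt (\<Sum>l<D. h l * h l)"
      have \<nu>: "\<nu> > 0" "\<nu> * \<nu> = (\<Sum>l<D. h l * h l)" using pos by (auto simp: \<nu>_def)
      define u where "u l = h l / \<nu>" for l
      have uu: "(\<Sum>l<D. u l * u l) = 1"
      proof -
        have "(\<Sum>l<D. u l * u l) = (\<Sum>l<D. h l * h l) / (\<nu> * \<nu>)"
          by (simp add: u_def sum_divide_distrib)
        then show ?thesis using \<nu> pos by simp
      qed
      have gu: "(\<Sum>l<D. g l c * u l) = 0" if "c < n" for c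
        using hg[OF that] by (simp add: u_def flip: sum_divide_distrib)
      define A where "A = (\<Sum>l<D. \<Sum>k<D. B l k * (g l b * g k b))"
      define E where "E = (\<Sum>l<D. \<Sum>k<D. B l k * (u l * u k))"
      have C: "(\<Sum>l<D. \<Sum>k<D. B l k * (u l * g k b)) = \<nu>"
      proof -
        have "(\<Sum>l<D. \<Sum>k<D. B l k * (u l * g k b)) = (\<Sum>l<D. u l * (\<Sum>k<D. B l k * g k b))"
          by (simp add: sum_distrib_left ac_simps)
        also have "\<dots> = (\<Sum>l<D. u l * h l) + (\<Sum>l<D. u l * (\<Sum>a<n. g l a * V a b))"
          by (simp add: h_def algebra_simps sum_subtractf)
        also have "(\<Sum>l<D. u l * (\<Sum>a<n. g l a * V a b)) = (\<Sum>l<D. \<Sum>a<n. (g l a * u l) * V a b)"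
          by (simp add: sum_distrib_left ac_simps)
        also have "\<dots> = (\<Sum>a<n. \<Sum>l<D. (g l a * u l) * V a b)" by (rule sum.swap)
        also have "\<dots> = 0" by (rule sum.neutral) (use gu in \<open>simp flip: sum_distrib_right\<close>)
        also have "(\<Sum>l<D. u l * h l) = (\<Sum>l<D. h l * h l) / \<nu>"
          by (simp add: u_def sum_divide_distrib)
        also have "\<dots> = \<nu>" using \<nu> by (simp add: field_simps)
        finally show ?thesis by simp
      qed
      have C': "(\<Sum>l<D. \<Sum>k<D. B l k * (g l b * u k)) = \<nu>"
        by (subst sum.swap) (use C Bsym in \<open>simp add: mult.commute[of "g _ b"]\<close>)
      have ineq: "2 * \<nu> \<le> \<tau> * (A - E)" if \<tau>: "0 < \<tau>" for \<tau>
      proof -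
        \<comment> \<open>rotation by the angle with tangent \<open>\<tau>\<close>\<close>
        define q where "q = sqrt (1 + \<tau> * \<tau>)"
        have q: "q > 0" "q * q = 1 + \<tau> * \<tau>" by (auto simp: q_def add_pos_nonneg)
        define \<gamma> where "\<gamma> = 1 / q"
        define \<delta> where "\<delta> = \<tau> / q"
        have "\<gamma> * \<gamma> + \<delta> * \<delta> = (1 + \<tau> * \<tau>) / (q * q)"
          by (simp add: \<gamma>_def \<delta>_def add_divide_distrib)
        then have \<gamma>\<delta>: "\<gamma> * \<gamma> + \<delta> * \<delta> = 1" using q(1) unfolding q(2)[symmetric] by simp
        define g' where "g' l = (g l)(b := \<gamma> * g l b + \<delta> * u l)" for l
        have "orthonormal_columns D n g'"
          unfolding orthonormal_columns_def
        proof (intro allI impI)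
          fix c d assume cd: "c < n" "d < n"
          have bb: "(\<Sum>l<D. (\<gamma> * g l b + \<delta> * u l) * (\<gamma> * g l b + \<delta> * u l)) = 1"
          proof -
            have "(\<Sum>l<D. (\<gamma> * g l b + \<delta> * u l) * (\<gamma> * g l b + \<delta> * u l))
              = \<gamma> * \<gamma> * (\<Sum>l<D. g l b * g l b) + 2 * \<gamma> * \<delta> * (\<Sum>l<D. g l b * u l) + \<delta> * \<delta> * (\<Sum>l<D. u l * u l)"
              unfolding sum_distrib_left sum.distrib[symmetric]
              by (intro sum.cong refl) (simp add: algebra_simps)
            then show ?thesis using on[OF b b] gu[OF b] uu \<gamma>\<delta> by simp
          qed
          have bc: "(\<Sum>l<D. g l c * (\<gamma> * g l b + \<delta> * u l)) = 0" if "c < n" "c \<noteq> b" for c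
          proof -
            have "(\<Sum>l<D. g l c * (\<gamma> * g l b + \<delta> * u l))
              = \<gamma> * (\<Sum>l<D. g l c * g l b) + \<delta> * (\<Sum>l<D. g l c * u l)"
              unfolding sum_distrib_left sum.distrib[symmetric]
              by (intro sum.cong refl) (simp add: algebra_simps)
            then show ?thesis using on[OF that(1) b] gu[OF that(1)] that(2) by simp
          qed
          show "(\<Sum>l<D. g' l c * g' l d) = (if c = d then 1 else 0)"
            using bb bc[OF cd(1)] bc[OF cd(2)] on[OF cd]
            by (cases "c = b"; cases "d = b") (simp_all add: g'_def mult.commute[of "_ + _" "g _ _"])
        qed
        from Fmax[OF this] have "F g' - F g \<le> 0" by simp
        moreover have "F g' - F g = (\<gamma> * \<gamma> - 1) * A + \<gamma> * \<delta> * (2 * \<nu>) + \<delta> * \<delta> * E"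
        proof -
          have "inner_upto n (g' l) (g' k) - inner_upto n (g l) (g k) = g' l b * g' k b - g l b * g k b" for l k
          proof -
            have "(\<Sum>a\<in>{..<n}-{b}. g' l a * g' k a) = (\<Sum>a\<in>{..<n}-{b}. g l a * g k a)"
              by (rule sum.cong) (auto simp: g'_def)
            then show ?thesis
              unfolding inner_upto_def using b by (simp add: sum.remove[of "{..<n}" b])
          qed
          then have "F g' - F g = (\<Sum>l<D. \<Sum>k<D. B l k * (g' l b * g' k b - g l b * g k b))"
            unfolding F_def sum_subtractf[symmetric] right_diff_distrib[symmetric] by simp
          also have "\<dots> = (\<Sum>l<D. \<Sum>k<D. (\<gamma> * \<gamma> - 1) * (B l k * (g l b * g k b))
             + (\<gamma> * \<delta> * (B l k * (u l * g k b)) + \<gamma> * \<delta> * (B l k * (g l b * u k))) + \<delta> * \<delta> * (B l k * (u l * u k)))"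
            by (intro sum.cong refl) (simp add: g'_def algebra_simps)
          also have "\<dots> = (\<gamma> * \<gamma> - 1) * A + (\<gamma> * \<delta> * \<nu> + \<gamma> * \<delta> * \<nu>) + \<delta> * \<delta> * E"
            unfolding sum.distrib sum_distrib_left[symmetric] C C' A_def E_def ..
          finally show ?thesis by simp
        qed
        ultimately have le: "(\<gamma> * \<gamma> - 1) * A + \<gamma> * \<delta> * (2 * \<nu>) + \<delta> * \<delta> * E \<le> 0" by simp
        have "\<gamma> * \<gamma> - 1 = - (\<delta> * \<delta>)" using \<gamma>\<delta> by linarith
        with le have "\<gamma> * \<delta> * (2 * \<nu>) \<le> \<delta> * \<delta> * (A - E)" by (simp add: algebra_simps)
        moreover have "\<delta> = \<tau> * \<gamma>" by (simp add: \<gamma>_def \<delta>_def)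
        ultimately have "(\<gamma> * \<gamma> * \<tau>) * (2 * \<nu>) \<le> (\<gamma> * \<gamma> * \<tau>) * (\<tau> * (A - E))" by (simp add: ac_simps)
        moreover have "0 < \<gamma>" using q(1) by (simp add: \<gamma>_def)
        then have "0 < \<gamma> * \<gamma> * \<tau>" using \<tau> by (intro mult_pos_pos)
        ultimately show ?thesis by (simp only: mult_le_cancel_left_pos)
      qed
      \<comment> \<open>small enough for the first-order gain \<open>2 \<nu>\<close> to exceed the second-order term\<close>
      define \<tau> where "\<tau> = \<nu> / (\<bar>A - E\<bar> + 1)"
      have d: "0 < \<bar>A - E\<bar> + 1" by simp
      have \<tau>: "\<tau> > 0" using \<nu> d by (simp add: \<tau>_def)
      have "\<tau> * (A - E) \<le> \<tau> * (\<bar>A - E\<bar> + 1)" by (rule mult_left_mono) (use \<tau> in auto)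
      also have "\<dots> = \<nu>" using d by (simp add: \<tau>_def)
      finally show False using ineq[OF \<tau>] \<nu> by simp
    qed
    then have "h l0 * h l0 = 0"
      using sum_nonneg_eq_0_iff[of "{..<D}" "\<lambda>l. h l * h l"] l0 by simp
    then show ?thesis by (simp add: h_def)
  qed
  have "(\<Sum>a<n. V a a) = (\<Sum>a<n. \<Sum>l<D. \<Sum>k<D. B l k * (g l a * g k a))"
    by (simp add: V_def ac_simps)
  also have "\<dots> = (\<Sum>l<D. \<Sum>a<n. \<Sum>k<D. B l k * (g l a * g k a))" by (rule sum.swap)
  also have "\<dots> = (\<Sum>l<D. \<Sum>k<D. \<Sum>a<n. B l k * (g l a * g k a))"
    by (rule sum.cong[OF refl], rule sum.swap)
  also have "\<dots> = F g" by (simp add: F_def inner_upto_def sum_distrib_left)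
  finally have "(\<Sum>a<n. V a a) = frame_energy D n s g" using Feq by simp
  with inv show thesis using that by blast
qed

section \<open>A maximal frame forces large projections\<close>

lemma independent_family:
  fixes x :: "nat \<Rightarrow> 'a::real_vector"
  assumes "\<And>u. (\<Sum>a<n. u a *\<^sub>R x a) = 0 \<Longrightarrow> \<forall>a<n. u a = 0"
  shows "inj_on x {..<n}" "independent (x ` {..<n})"
proof -
  show inj: "inj_on x {..<n}"
  proof (rule inj_onI, rule ccontr)
    fix a b assume ab: "a \<in> {..<n}" "b \<in> {..<n}" "x a = x b" "a \<noteq> b"
    define u where "u c = (if c = a then 1 else 0) - (if c = b then 1 else 0 :: real)" for c
    have "(\<Sum>c<n. u c *\<^sub>R x c) = (\<Sum>c<n. (if c = a then x c else 0) - (if c = b then x c else 0))"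
      by (rule sum.cong) (auto simp: u_def)
    also have "\<dots> = 0" using ab by (simp add: sum_subtractf)
    finally have "u a = 0" using assms ab by simp
    then show False using ab by (simp add: u_def)
  qed
  show "independent (x ` {..<n})"
  proof (rule independent_if_scalars_zero)
    fix f v assume f: "(\<Sum>v\<in>x ` {..<n}. f v *\<^sub>R v) = 0" and "v \<in> x ` {..<n}"
    then obtain a where a: "a < n" "v = x a" by auto
    have "(\<Sum>a<n. f (x a) *\<^sub>R x a) = 0" using f by (simp add: sum.reindex[OF inj])
    from assms[OF this] show "f v = 0" using a by simp
  qed simp
qed

lemma span_family:
  fixes x :: "nat \<Rightarrow> 'a::real_vector"
  assumes "z \<in> span (x ` {..<n})"
  obtains u where "z = (\<Sum>a<n. u a *\<^sub>R x a)"
  using assms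
proof (induction n arbitrary: z thesis)
  case 0
  then show ?case by simp
next
  case (Suc n)
  have "z \<in> span (insert (x n) (x ` {..<n}))" using Suc.prems(2) by (simp add: lessThan_Suc)
  then obtain k where "z - k *\<^sub>R x n \<in> span (x ` {..<n})" using span_breakdown_eq by blast
  from Suc.IH[OF _ this] obtain u where u: "z - k *\<^sub>R x n = (\<Sum>a<n. u a *\<^sub>R x a)" by blast
  have "(\<Sum>a<n. (u(n := k)) a *\<^sub>R x a) = (\<Sum>a<n. u a *\<^sub>R x a)"
    by (rule sum.cong) auto
  then have "z = (\<Sum>a<Suc n. (u(n := k)) a *\<^sub>R x a)" using u by (simp add: algebra_simps)
  then show ?case using Suc.prems(1) by blast
qed

text \<open>  Injectivity of the space of bounded sequences, obtained by extending each coordinate separately.\<close>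

lemma extend_to_contraction:
  assumes E: "subspace E" and T: "linear T" "\<And>z. z \<in> E \<Longrightarrow> norm (T z) = norm z"
  obtains S :: "linf \<Rightarrow> linf" where "linear S" "\<And>z. norm (S z) \<le> norm z" "\<And>z. z \<in> E \<Longrightarrow> S z = T z"
proof -
  have "\<exists>f. linear_on_subspace UNIV f \<and> (\<forall>z\<in>E. f z = apply_bcontfun (T z) j) \<and> (\<forall>z. f z \<le> norm z)" for j
  proof -
    have lin: "linear_on_subspace E (\<lambda>z. apply_bcontfun (T z) j)"
      using T(1) by (simp add: linear_on_subspace_def linear_add linear_scale)
    have "apply_bcontfun (T z) j \<le> norm z" if "z \<in> E" for z
      using norm_bounded[of "T z" j] T(2)[OF that] by simp
    from hahn_banach[of UNIV E norm, OF _ E _ _ _ lin this] show ?thesis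
      by (metis UNIV_I norm_triangle_ineq norm_scaleR abs_of_nonneg subset_UNIV subspace_UNIV)
  qed
  then obtain f where f: "\<And>j. linear_on_subspace UNIV (f j)"
    "\<And>j z. z \<in> E \<Longrightarrow> f j z = apply_bcontfun (T z) j" "\<And>j z. f j z \<le> norm z" by metis
  have fb: "\<bar>f j z\<bar> \<le> norm z" for j z
  proof -
    have "f j ((-1) *\<^sub>R z) = (-1) * f j z" using f(1)[of j] unfolding linear_on_subspace_def by blast
    then show ?thesis using f(3)[of j z] f(3)[of j "(-1) *\<^sub>R z"] by simp
  qed
  define S where "S z = Bcontfun (\<lambda>j. f j z)" for z
  have Sj: "apply_bcontfun (S z) j = f j z" for z j
    unfolding S_def by (subst apply_Bcontfun_bounded[where B = "norm z"]) (use fb in auto)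
  show thesis
  proof (rule that[of S])
    show "linear S"
      by (rule linearI; rule bcontfun_eqI) (use f(1) in \<open>auto simp: Sj linear_on_subspace_def\<close>)
    show "norm (S z) \<le> norm z" for z by (rule norm_bound) (simp add: Sj fb)
    show "S z = T z" if "z \<in> E" for z by (rule bcontfun_eqI) (simp add: Sj f(2) that)
  qed
qed

lemma linf_d_expand:
  assumes "x \<in> linf_d D"
  shows "x = (\<Sum>l<D. apply_bcontfun x l *\<^sub>R single l 1)"
proof (rule bcontfun_eqI)
  fix j
  have "(\<Sum>l<D. apply_bcontfun x l * (if j = l then 1 else 0)) = (if j < D then apply_bcontfun x j else 0)"
    by (simp add: mult_delta_right)
  then show "apply_bcontfun x j = apply_bcontfun (\<Sum>l<D. apply_bcontfun x l *\<^sub>R single l 1) j"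
    using assms by (auto simp: linf_d_def)
qed

text \<open>  Let \<open>W\<close> be the matrix \<open>\<epsilon>\<^sub>l\<^sub>k w\<^sub>k\<close> on \<open>\<real>\<^sup>D\<close>; it maps \<open>E\<close> into \<open>E\<close> and acts there as \<open>V\<close>. Let \<open>Q\<close> be a
  projection onto \<open>E\<close> with values \<open>Q l\<close> at the unit vectors \<open>e\<^sub>l\<close>. The trace of \<open>W Q\<close> is that of \<open>V\<close>. It
  is also \<open>\<Sum>\<^sub>k w\<^sub>k (Q (\<Sum>\<^sub>l \<epsilon>\<^sub>l\<^sub>k e\<^sub>l))\<^sub>k\<close>, an average of numbers that do not exceed the norm of \<open>Q\<close>,
  because the vectors \<open>\<Sum>\<^sub>l \<epsilon>\<^sub>l\<^sub>k e\<^sub>l\<close> have norm at most \<open>1\<close>. A projection \<open>P\<close> onto an isometric copy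
  \<open>T ` E\<close> is turned into such a \<open>Q\<close>, of no larger norm, by composing it with a contraction that
  extends \<open>T\<close>.\<close>

lemma trace_duality:
  fixes x :: "nat \<Rightarrow> linf" and \<epsilon> :: "nat \<Rightarrow> nat \<Rightarrow> real"
  assumes xd: "\<And>a. a < n \<Longrightarrow> x a \<in> linf_d D"
    and indep: "\<And>u. (\<Sum>a<n. u a *\<^sub>R x a) = 0 \<Longrightarrow> \<forall>a<n. u a = 0"
    and E: "E = span (x ` {..<n})"
    and \<epsilon>: "\<And>l k. \<bar>\<epsilon> l k\<bar> \<le> 1" and w: "\<And>k. k < D \<Longrightarrow> 0 \<le> w k" "(\<Sum>k<D. w k) = 1"
    and V: "\<And>l b. l < D \<Longrightarrow> b < n \<Longrightarrow>
      (\<Sum>k<D. \<epsilon> l k * w k * apply_bcontfun (x b) k) = (\<Sum>a<n. apply_bcontfun (x a) l * V a b)"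
    and T: "isometric_embedding E norm T" and P: "projection_onto (T ` E) P"
  shows "(\<Sum>a<n. V a a) \<le> onorm P"
proof -
  have Tlin: "linear T" and Tn: "\<And>z. z \<in> E \<Longrightarrow> norm (T z) = norm z"
    using T by (auto simp: isometric_embedding_def)
  have subE: "subspace E" by (simp add: E)
  have xE: "x a \<in> E" if "a < n" for a unfolding E using that by (auto intro: span_base)
  have sumE: "(\<Sum>a<n. u a *\<^sub>R x a) \<in> E" for u
    using subE xE by (auto intro!: subspace_sum subspace_scale)
  have Pbl: "bounded_linear P" and Pr: "range P = T ` E" and PP: "\<And>z. P (P z) = P z"
    using P by (auto simp: projection_onto_def fun_eq_iff)
  have Plin: "linear P" using Pbl by (rule bounded_linear.linear)
  have Pid: "P (T z) = T z" if "z \<in> E" for z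
    using that Pr PP by (metis image_eqI rangeE)
  obtain S where S: "linear S" "\<And>z. norm (S z) \<le> norm z" "\<And>z. z \<in> E \<Longrightarrow> S z = T z"
    using extend_to_contraction[OF subE Tlin Tn] by blast
  define R where "R z = P (S z)" for z
  have Rlin: "linear R" unfolding R_def[abs_def] using linear_compose[OF S(1) Plin] by (simp add: o_def)
  have Rn: "norm (R z) \<le> onorm P * norm z" for z
  proof -
    have "norm (R z) \<le> onorm P * norm (S z)" unfolding R_def by (rule onorm[OF Pbl])
    also have "\<dots> \<le> onorm P * norm z" by (rule mult_left_mono[OF S(2) onorm_pos_le[OF Pbl]])
    finally show ?thesis .
  qed
  have "\<exists>u. R z = T (\<Sum>a<n. u a *\<^sub>R x a)" for z
  proof -
    have "R z \<in> T ` E" using Pr by (auto simp: R_def)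
    then obtain y where y: "y \<in> E" "R z = T y" by blast
    obtain u where "y = (\<Sum>a<n. u a *\<^sub>R x a)" using span_family y(1) unfolding E by blast
    then show ?thesis using y(2) by blast
  qed
  then have "\<exists>c. \<forall>l. R (single l 1) = T (\<Sum>a<n. c l a *\<^sub>R x a)"
    using choice[of "\<lambda>l u. R (single l 1) = T (\<Sum>a<n. u a *\<^sub>R x a)"] by blast
  then obtain c where c: "\<And>l. R (single l 1) = T (\<Sum>a<n. c l a *\<^sub>R x a)" by blast
  define Q where "Q l = (\<Sum>a<n. c l a *\<^sub>R x a)" for l
  have QE: "Q l \<in> E" for l unfolding Q_def by (rule sumE)
  have Tsum: "T (\<Sum>l<D. \<alpha> l *\<^sub>R Q l) = R (\<Sum>l<D. \<alpha> l *\<^sub>R single l 1)" for \<alpha>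
    by (simp add: linear_sum[OF Tlin] linear_sum[OF Rlin] linear_scale[OF Tlin] linear_scale[OF Rlin] c Q_def)
  have QsumE: "(\<Sum>l<D. \<alpha> l *\<^sub>R Q l) \<in> E" for \<alpha>
    using subE QE by (auto intro!: subspace_sum subspace_scale)
  \<comment> \<open>the vectors \<open>Q l\<close> reproduce \<open>E\<close>, so their coefficients are dual to the \<open>x b\<close>\<close>
  have xQ: "x b = (\<Sum>l<D. apply_bcontfun (x b) l *\<^sub>R Q l)" if b: "b < n" for b
  proof -
    have "T (\<Sum>l<D. apply_bcontfun (x b) l *\<^sub>R Q l) = T (x b)"
      unfolding Tsum linf_d_expand[OF xd[OF b], symmetric] R_def S(3)[OF xE[OF b]] Pid[OF xE[OF b]] ..
    then have "norm (T (x b - (\<Sum>l<D. apply_bcontfun (x b) l *\<^sub>R Q l))) = 0"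
      by (simp add: linear_diff[OF Tlin])
    then have "norm (x b - (\<Sum>l<D. apply_bcontfun (x b) l *\<^sub>R Q l)) = 0"
      using Tn[OF subspace_diff[OF subE xE[OF b] QsumE]] by simp
    then show ?thesis by simp
  qed
  have biorth: "(\<Sum>l<D. apply_bcontfun (x b) l * c l a) = (if a = b then 1 else 0)" if "a < n" "b < n" for a b
  proof -
    define u where "u a = (\<Sum>l<D. apply_bcontfun (x b) l * c l a) - (if a = b then 1 else 0)" for a
    have "(\<Sum>l<D. apply_bcontfun (x b) l *\<^sub>R Q l) = (\<Sum>l<D. \<Sum>a<n. (apply_bcontfun (x b) l * c l a) *\<^sub>R x a)"
      by (simp add: Q_def scaleR_sum_right)
    also have "\<dots> = (\<Sum>a<n. \<Sum>l<D. (apply_bcontfun (x b) l * c l a) *\<^sub>R x a)" by (rule sum.swap)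
    finally have "(\<Sum>a<n. (\<Sum>l<D. apply_bcontfun (x b) l * c l a) *\<^sub>R x a) = x b"
      using xQ[OF that(2)] by (simp add: scaleR_sum_left)
    moreover have "(\<Sum>a<n. (if a = b then 1 else 0) *\<^sub>R x a) = (\<Sum>a<n. if a = b then x a else 0)"
      by (rule sum.cong) auto
    ultimately have "(\<Sum>a<n. u a *\<^sub>R x a) = 0"
      using that by (simp add: u_def scaleR_diff_left sum_subtractf)
    from indep[OF this] show ?thesis using that by (simp add: u_def)
  qed
  \<comment> \<open>the trace of the composite, first through \<open>V\<close>, then through the norm of \<open>P\<close>\<close>
  have "(\<Sum>l<D. \<Sum>k<D. \<epsilon> l k * w k * apply_bcontfun (Q l) k) = (\<Sum>l<D. \<Sum>b<n. \<Sum>a<n. V a b * (apply_bcontfun (x a) l * c l b))"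
  proof (rule sum.cong[OF refl])
    fix l assume l: "l \<in> {..<D}"
    have "(\<Sum>k<D. \<epsilon> l k * w k * apply_bcontfun (Q l) k) = (\<Sum>k<D. \<Sum>b<n. c l b * (\<epsilon> l k * w k * apply_bcontfun (x b) k))"
      by (simp add: Q_def sum_distrib_left ac_simps)
    also have "\<dots> = (\<Sum>b<n. \<Sum>k<D. c l b * (\<epsilon> l k * w k * apply_bcontfun (x b) k))" by (rule sum.swap)
    also have "\<dots> = (\<Sum>b<n. c l b * (\<Sum>a<n. apply_bcontfun (x a) l * V a b))"
      by (rule sum.cong[OF refl]) (use V l in \<open>simp flip: sum_distrib_left\<close>)
    also have "\<dots> = (\<Sum>b<n. \<Sum>a<n. V a b * (apply_bcontfun (x a) l * c l b))"
      by (simp add: sum_distrib_left ac_simps)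
    finally show "(\<Sum>k<D. \<epsilon> l k * w k * apply_bcontfun (Q l) k) = (\<Sum>b<n. \<Sum>a<n. V a b * (apply_bcontfun (x a) l * c l b))" .
  qed
  also have "\<dots> = (\<Sum>b<n. \<Sum>l<D. \<Sum>a<n. V a b * (apply_bcontfun (x a) l * c l b))" by (rule sum.swap)
  also have "\<dots> = (\<Sum>b<n. \<Sum>a<n. \<Sum>l<D. V a b * (apply_bcontfun (x a) l * c l b))"
    by (rule sum.cong[OF refl], rule sum.swap)
  also have "\<dots> = (\<Sum>b<n. \<Sum>a<n. if b = a then V a b else 0)"
  proof (intro sum.cong refl)
    fix b a assume "b \<in> {..<n}" "a \<in> {..<n}"
    then show "(\<Sum>l<D. V a b * (apply_bcontfun (x a) l * c l b)) = (if b = a then V a b else 0)"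
      using biorth[of b a] by (simp flip: sum_distrib_left)
  qed
  also have "\<dots> = (\<Sum>b<n. V b b)" by simp
  finally have val: "(\<Sum>b<n. V b b) = (\<Sum>l<D. \<Sum>k<D. \<epsilon> l k * w k * apply_bcontfun (Q l) k)" by simp
  also have "\<dots> = (\<Sum>k<D. \<Sum>l<D. \<epsilon> l k * w k * apply_bcontfun (Q l) k)" by (rule sum.swap)
  also have "\<dots> = (\<Sum>k<D. w k * apply_bcontfun (\<Sum>l<D. \<epsilon> l k *\<^sub>R Q l) k)"
    by (simp add: sum_distrib_left ac_simps)
  also have "\<dots> \<le> (\<Sum>k<D. w k * onorm P)"
  proof (intro sum_mono mult_left_mono)
    fix k assume k: "k \<in> {..<D}"
    show "0 \<le> w k" using w k by simp
    have "norm (\<Sum>l<D. \<epsilon> l k *\<^sub>R (single l 1 :: linf)) \<le> 1"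
    proof (rule norm_bound)
      fix i
      have "(\<Sum>l<D. \<epsilon> l k * (if i = l then 1 else 0)) = (if i < D then \<epsilon> i k else 0)"
        by (simp add: mult_delta_right)
      then show "norm (apply_bcontfun (\<Sum>l<D. \<epsilon> l k *\<^sub>R (single l 1 :: linf)) i) \<le> 1"
        using \<epsilon>[of i k] by auto
    qed
    then have "onorm P * norm (\<Sum>l<D. \<epsilon> l k *\<^sub>R (single l 1 :: linf)) \<le> onorm P * 1"
      by (rule mult_left_mono) (rule onorm_pos_le[OF Pbl])
    moreover have "norm (\<Sum>l<D. \<epsilon> l k *\<^sub>R Q l) = norm (R (\<Sum>l<D. \<epsilon> l k *\<^sub>R single l 1))"
      using Tn[OF QsumE] Tsum by metis
    ultimately have "norm (\<Sum>l<D. \<epsilon> l k *\<^sub>R Q l) \<le> onorm P"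
      using Rn[of "\<Sum>l<D. \<epsilon> l k *\<^sub>R single l 1"] by simp
    then show "apply_bcontfun (\<Sum>l<D. \<epsilon> l k *\<^sub>R Q l) k \<le> onorm P"
      using norm_bounded[of "\<Sum>l<D. \<epsilon> l k *\<^sub>R Q l" k] by (simp del: apply_bcontfun_sum)
  qed
  also have "\<dots> = onorm P" using w(2) by (simp flip: sum_distrib_right)
  finally show ?thesis .
qed

text \<open>  The space is spanned by the columns of \<open>g\<^sub>l / s\<^sub>l\<close>. A row with \<open>s\<^sub>l = 0\<close> is left as it is: the same
  row of the invariance relation reads \<open>0 = \<Sum>\<^sub>a g\<^sub>l(a) V\<^sub>a\<^sub>b\<close>, so the relation needed for trace duality
  holds there with the signs \<open>\<epsilon>\<^sub>l\<^sub>k\<close> replaced by \<open>0\<close>.\<close>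

lemma subspace_from_maximal_frame:
  fixes s :: "nat \<Rightarrow> real" and g :: "nat \<Rightarrow> nat \<Rightarrow> real" and D n :: nat
  assumes s: "unit_weights D s" and g: "orthonormal_columns D n g"
    and max: "\<And>s' g'. unit_weights D s' \<Longrightarrow> orthonormal_columns D n g' \<Longrightarrow> frame_energy D n s' g' \<le> frame_energy D n s g"
  obtains E where "subspace_of_dim n E" "E \<subseteq> linf_d D"
    "\<And>T P. isometric_embedding E norm T \<Longrightarrow> projection_onto (T ` E) P \<Longrightarrow> frame_energy D n s g \<le> onorm P"
proof -
  have s0: "0 \<le> s l" if "l < D" for l using s that by (simp add: unit_weights_def)
  obtain V where V: "\<And>l b. l < D \<Longrightarrow> b < n \<Longrightarrow>
      (\<Sum>k<D. s l * sign_matrix n g l k * s k * g k b) = (\<Sum>a<n. g l a * V a b)"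
    and tr: "(\<Sum>a<n. V a a) = frame_energy D n s g"
    using maximal_frame_invariant[of D s n g, OF s0 g max[OF s]] by blast
  define \<xi> where "\<xi> l a = (if s l = 0 then g l a else g l a / s l)" for l a
  define x where "x a = (\<Sum>l<D. \<xi> l a *\<^sub>R (single l 1 :: linf))" for a
  have xl: "apply_bcontfun (x a) l = (if l < D then \<xi> l a else 0)" for a l
  proof -
    have "(\<Sum>k<D. \<xi> k a * (if l = k then 1 else 0)) = (if l < D then \<xi> l a else 0)"
      by (simp add: mult_delta_right)
    then show ?thesis by (simp add: x_def)
  qed
  have xd: "x a \<in> linf_d D" for a by (simp add: linf_d_def xl)
  have indep: "\<forall>a<n. u a = 0" if u: "(\<Sum>a<n. u a *\<^sub>R x a) = 0" for u
  proof (intro allI impI)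
    fix b assume b: "b < n"
    have z: "(\<Sum>a<n. u a * g l a) = 0" if l: "l < D" for l
    proof -
      have "(\<Sum>a<n. u a * \<xi> l a) = 0"
        using arg_cong[OF u, of "\<lambda>f. apply_bcontfun f l"] l by (simp add: xl)
      moreover have "(\<Sum>a<n. u a * g l a) = (if s l = 0 then 1 else s l) * (\<Sum>a<n. u a * \<xi> l a)"
        unfolding sum_distrib_left by (rule sum.cong) (auto simp: \<xi>_def)
      ultimately show ?thesis by simp
    qed
    have "0 = (\<Sum>l<D. g l b * (\<Sum>a<n. u a * g l a))" using z by simp
    also have "\<dots> = (\<Sum>l<D. \<Sum>a<n. u a * (g l b * g l a))" by (simp add: sum_distrib_left ac_simps)
    also have "\<dots> = (\<Sum>a<n. \<Sum>l<D. u a * (g l b * g l a))" by (rule sum.swap)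
    also have "\<dots> = (\<Sum>a<n. u a * (if b = a then 1 else 0))"
      by (rule sum.cong[OF refl]) (use g b in \<open>simp add: orthonormal_columns_def flip: sum_distrib_left\<close>)
    also have "\<dots> = u b" using b by (simp add: mult_delta_right)
    finally show "u b = 0" by simp
  qed
  define E where "E = span (x ` {..<n})"
  note ind = independent_family[of x n, OF indep]
  have dim: "subspace_of_dim n E"
    by (rule subspace_of_dimI[OF _ ind(2)]) (simp_all add: E_def card_image[OF ind(1)])
  have "subspace (linf_d D)" by (auto simp: subspace_def linf_d_def)
  then have ED: "E \<subseteq> linf_d D" unfolding E_def using xd by (intro span_minimal) auto
  define \<epsilon> where "\<epsilon> l k = (if s l = 0 then 0 else sign_matrix n g l k)" for l k
  have rel: "(\<Sum>k<D. \<epsilon> l k * (s k * s k) * apply_bcontfun (x b) k) = (\<Sum>a<n. apply_bcontfun (x a) l * V a b)"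
    if l: "l < D" and b: "b < n" for l b
  proof -
    have weight: "s k * s k * \<xi> k b = s k * g k b" for k by (simp add: \<xi>_def)
    have "(\<Sum>k<D. \<epsilon> l k * (s k * s k) * apply_bcontfun (x b) k) = (\<Sum>k<D. \<epsilon> l k * (s k * g k b))"
      by (rule sum.cong) (simp_all add: xl mult.assoc weight[unfolded mult.assoc])
    also have "\<dots> = (\<Sum>a<n. \<xi> l a * V a b)"
    proof (cases "s l = 0")
      case True
      then show ?thesis using V[OF l b] by (simp add: \<epsilon>_def \<xi>_def)
    next
      case False
      have "s l * (\<Sum>k<D. \<epsilon> l k * (s k * g k b)) = (\<Sum>a<n. g l a * V a b)"
        using V[OF l b] False by (simp add: \<epsilon>_def sum_distrib_left mult.assoc)
      also have "\<dots> = s l * (\<Sum>a<n. \<xi> l a * V a b)"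
        unfolding sum_distrib_left by (rule sum.cong) (use False in \<open>auto simp: \<xi>_def\<close>)
      finally show ?thesis using False by simp
    qed
    finally show ?thesis using l by (simp add: xl)
  qed
  have "frame_energy D n s g \<le> onorm P"
    if "isometric_embedding E norm T" "projection_onto (T ` E) P" for T P
    unfolding tr[symmetric]
  proof (rule trace_duality[of n x D E \<epsilon> "\<lambda>k. s k * s k" V T P])
    show "\<bar>\<epsilon> l k\<bar> \<le> 1" for l k by (simp add: \<epsilon>_def sign_matrix_def abs_sgn_eq)
    show "(\<Sum>k<D. s k * s k) = 1" using s by (simp add: unit_weights_def)
  qed (use xd indep E_def rel that in auto)
  with dim ED that show thesis by blast
qed

section \<open>Subspaces of the finite-dimensional maximum norm are polyhedral\<close>

lemma sum_sum_add_swap: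
  fixes a b :: "'s \<Rightarrow> 't \<Rightarrow> 'c::comm_monoid_add"
  shows "(\<Sum>s\<in>L. \<Sum>t\<in>U. a s t + b s t) = (\<Sum>s\<in>L. \<Sum>t\<in>U. a s t) + (\<Sum>t\<in>U. \<Sum>s\<in>L. b s t)"
  using sum.swap[of b U L] by (simp add: sum.distrib)

text \<open>  The new vertices are the old ones below the hyperplane and the points \<open>q s t\<close> where a segment from
  a vertex \<open>s\<close> below to a vertex \<open>t\<close> above crosses it. Given a convex combination below the
  hyperplane, let \<open>A\<close> be the total excess of its vertices above and \<open>B \<ge> A\<close> the total deficit of those
  below. Pairing each \<open>t\<close> with each \<open>s\<close>, in proportion to excess and deficit, uses up the weight of
  every \<open>t\<close> and the fraction \<open>A / B\<close> of the weight of every \<open>s\<close>.\<close>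

lemma polytope_Int_halfspace:
  fixes f :: "'a::real_vector \<Rightarrow> real"
  assumes "polytope P" and f: "linear f"
  shows "polytope (P \<inter> {x. f x \<le> c})"
proof -
  obtain S where S: "finite S" "P = convex hull S" using assms(1) by (auto simp: polytope_def)
  define L where "L = {s\<in>S. f s \<le> c}"
  define U where "U = {s\<in>S. c < f s}"
  have fin: "finite L" "finite U" using S by (auto simp: L_def U_def)
  have SLU: "S = L \<union> U" "L \<inter> U = {}" by (auto simp: L_def U_def)
  define q where "q s t = ((f t - c) / (f t - f s)) *\<^sub>R s + ((c - f s) / (f t - f s)) *\<^sub>R t" for s t
  define X where "X = L \<union> (\<lambda>(s, t). q s t) ` (L \<times> U)"
  have finX: "finite X" using fin by (simp add: X_def)
  have wt: "0 \<le> (f t - c) / (f t - f s)" "0 \<le> (c - f s) / (f t - f s)"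
    "(f t - c) / (f t - f s) + (c - f s) / (f t - f s) = 1" if "s \<in> L" "t \<in> U" for s t
    using that by (auto simp: L_def U_def simp flip: add_divide_distrib)
  have "P \<inter> {x. f x \<le> c} = convex hull X"
  proof
    have conv: "convex (P \<inter> {x. f x \<le> c})"
    proof (rule convex_Int)
      show "convex P" by (simp add: S)
      show "convex {x. f x \<le> c}"
        unfolding convex_def using convex_bound_le[of _ c]
        by (auto simp: linear_add[OF f] linear_scale[OF f])
    qed
    have "X \<subseteq> P \<inter> {x. f x \<le> c}"
    proof -
      have "L \<subseteq> P \<inter> {x. f x \<le> c}" using hull_subset[of S convex] by (auto simp: S L_def)
      moreover have "q s t \<in> P \<inter> {x. f x \<le> c}" if st: "s \<in> L" "t \<in> U" for s t
      proof -
        have "s \<in> P" "t \<in> P" using st hull_subset[of S convex] by (auto simp: S L_def U_def)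
        then have "q s t \<in> P" unfolding q_def S(2)
          using convexD[OF convex_convex_hull] wt[OF st] by blast
        moreover have "f (q s t) = c"
        proof -
          have ne: "f t - f s \<noteq> 0" using st by (auto simp: L_def U_def)
          have "f (q s t) = ((f t - c) * f s + (c - f s) * f t) / (f t - f s)"
            by (simp add: q_def linear_add[OF f] linear_scale[OF f] add_divide_distrib)
          also have "(f t - c) * f s + (c - f s) * f t = c * (f t - f s)" by (simp add: algebra_simps)
          finally show ?thesis using ne by simp
        qed
        ultimately show ?thesis by simp
      qed
      ultimately show ?thesis by (auto simp: X_def)
    qed
    then show "convex hull X \<subseteq> P \<inter> {x. f x \<le> c}" using conv by (rule hull_minimal)
  next
    show "P \<inter> {x. f x \<le> c} \<subseteq> convex hull X"
    proof
      fix x assume x: "x \<in> P \<inter> {x. f x \<le> c}"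
      then obtain u where u: "\<And>s. s \<in> S \<Longrightarrow> 0 \<le> u s" "sum u S = 1" "(\<Sum>s\<in>S. u s *\<^sub>R s) = x"
        using S convex_hull_finite[OF S(1)] by auto
      have split: "sum h S = sum h L + sum h U" for h :: "'a \<Rightarrow> real"
        unfolding SLU(1) by (rule sum.union_disjoint[OF fin SLU(2)])
      have splitv: "sum h S = sum h L + sum h U" for h :: "'a \<Rightarrow> 'a"
        unfolding SLU(1) by (rule sum.union_disjoint[OF fin SLU(2)])
      define A where "A = (\<Sum>t\<in>U. u t * (f t - c))"
      define B where "B = (\<Sum>s\<in>L. u s * (c - f s))"
      have uL: "0 \<le> u s" if "s \<in> L" for s using u(1) that by (simp add: L_def)
      have uU: "0 \<le> u s" if "s \<in> U" for s using u(1) that by (simp add: U_def)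
      have A0: "0 \<le> A" unfolding A_def using uU by (auto intro!: sum_nonneg simp: U_def)
      have "f x = (\<Sum>s\<in>S. u s * f s)" by (simp add: u(3)[symmetric] linear_sum[OF f] linear_scale[OF f])
      then have "f x - c = (\<Sum>s\<in>S. u s * (f s - c))"
        using u(2) by (simp add: right_diff_distrib sum_subtractf flip: sum_distrib_right)
      also have "\<dots> = A - B" unfolding split A_def B_def
        by (simp add: right_diff_distrib sum_subtractf)
      finally have AB: "A \<le> B" using x by simp
      show "x \<in> convex hull X"
      proof (cases "A = 0")
        case True
        have "u t = 0" if t: "t \<in> U" for t
        proof -
          have "u t * (f t - c) = 0"
            using sum_nonneg_eq_0_iff[OF fin(2), of "\<lambda>t. u t * (f t - c)"] True uU t
            by (auto simp: A_def U_def)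
          then show ?thesis using t by (simp add: U_def)
        qed
        then have "sum u L = 1" "(\<Sum>s\<in>L. u s *\<^sub>R s) = x" using u(2,3) split[of u] splitv by simp_all
        then show ?thesis
          using convex_sum[OF fin(1) convex_convex_hull[of X], of u "\<lambda>s. s"] uL hull_subset[of X convex]
          by (auto simp: X_def)
      next
        case False
        then have B: "B > 0" and AB1: "A / B \<le> 1" using A0 AB by auto
        define w :: "'a + 'a \<times> 'a \<Rightarrow> real" where
          "w i = (case i of Inl s \<Rightarrow> u s * (1 - A / B) | Inr (s, t) \<Rightarrow> u s * u t * (f t - f s) / B)" for i
        define y :: "'a + 'a \<times> 'a \<Rightarrow> 'a" where
          "y i = (case i of Inl s \<Rightarrow> s | Inr (s, t) \<Rightarrow> q s t)" for i
        let ?I = "L <+> (L \<times> U)"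
        have finI: "finite ?I" using fin by simp
        have w0: "0 \<le> w i" if "i \<in> ?I" for i
          using that uL uU AB1 B by (auto simp: w_def L_def U_def intro!: mult_nonneg_nonneg divide_nonneg_pos)
        have yX: "y i \<in> convex hull X" if "i \<in> ?I" for i
          using that hull_subset[of X convex] by (auto simp: y_def X_def)
        have cross: "(\<Sum>(s, t)\<in>L \<times> U. u s * u t * (f t - f s) / B) = (A / B) * sum u L + sum u U"
        proof -
          have "(\<Sum>(s, t)\<in>L \<times> U. u s * u t * (f t - f s) / B)
              = (\<Sum>s\<in>L. \<Sum>t\<in>U. u s * (u t * (f t - c)) / B + u t * (u s * (c - f s)) / B)"
            unfolding sum.cartesian_product[symmetric]
            by (intro sum.cong refl) (simp add: algebra_simps diff_divide_distrib add_divide_distrib)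
          also have "\<dots> = (\<Sum>s\<in>L. u s * A / B) + (\<Sum>t\<in>U. \<Sum>s\<in>L. u t * (u s * (c - f s)) / B)"
            unfolding sum_sum_add_swap A_def by (simp add: sum_distrib_left sum_divide_distrib)
          also have "(\<Sum>t\<in>U. \<Sum>s\<in>L. u t * (u s * (c - f s)) / B) = (\<Sum>t\<in>U. u t * B / B)"
            unfolding B_def[of] by (simp add: sum_distrib_left sum_divide_distrib)
          also have "\<dots> = sum u U" using B by simp
          also have "(\<Sum>s\<in>L. u s * A / B) = (A / B) * sum u L"
            unfolding sum_distrib_left by (rule sum.cong) simp_all
          finally show ?thesis .
        qed
        have crossv: "(\<Sum>(s, t)\<in>L \<times> U. (u s * u t * (f t - f s) / B) *\<^sub>R q s t)
            = (A / B) *\<^sub>R (\<Sum>s\<in>L. u s *\<^sub>R s) + (\<Sum>t\<in>U. u t *\<^sub>R t)"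
        proof -
          have "(\<Sum>(s, t)\<in>L \<times> U. (u s * u t * (f t - f s) / B) *\<^sub>R q s t)
              = (\<Sum>s\<in>L. \<Sum>t\<in>U. (u s * (u t * (f t - c)) / B) *\<^sub>R s + (u t * (u s * (c - f s)) / B) *\<^sub>R t)"
            unfolding sum.cartesian_product[symmetric]
          proof (intro sum.cong refl)
            fix s t assume "s \<in> L" "t \<in> U"
            then have "f t - f s \<noteq> 0" by (auto simp: L_def U_def)
            then show "(u s * u t * (f t - f s) / B) *\<^sub>R q s t
              = (u s * (u t * (f t - c)) / B) *\<^sub>R s + (u t * (u s * (c - f s)) / B) *\<^sub>R t"
              by (simp add: q_def scaleR_add_right ac_simps)
          qed
          also have "\<dots> = (\<Sum>s\<in>L. (u s * A / B) *\<^sub>R s) + (\<Sum>t\<in>U. \<Sum>s\<in>L. (u t * (u s * (c - f s)) / B) *\<^sub>R t)"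
            unfolding sum_sum_add_swap A_def
            by (simp add: sum_distrib_left sum_divide_distrib scaleR_sum_left)
          also have "(\<Sum>t\<in>U. \<Sum>s\<in>L. (u t * (u s * (c - f s)) / B) *\<^sub>R t) = (\<Sum>t\<in>U. (u t * B / B) *\<^sub>R t)"
            unfolding B_def by (simp add: sum_distrib_left sum_divide_distrib scaleR_sum_left)
          also have "\<dots> = (\<Sum>t\<in>U. u t *\<^sub>R t)" using B by simp
          finally show ?thesis by (simp add: scaleR_sum_right ac_simps)
        qed
        have "sum w ?I = (1 - A / B) * sum u L + ((A / B) * sum u L + sum u U)"
          unfolding cross[symmetric]
          by (subst sum.Plus) (use fin in \<open>auto simp: w_def sum_distrib_right mult.commute[of "1 - A / B"] case_prod_unfold\<close>)
        also have "\<dots> = 1" using u(2) split[of u] by (simp add: algebra_simps)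
        finally have w1: "sum w ?I = 1" .
        have "(\<Sum>i\<in>?I. w i *\<^sub>R y i) = (1 - A / B) *\<^sub>R (\<Sum>s\<in>L. u s *\<^sub>R s)
            + ((A / B) *\<^sub>R (\<Sum>s\<in>L. u s *\<^sub>R s) + (\<Sum>t\<in>U. u t *\<^sub>R t))"
          unfolding crossv[symmetric]
          by (subst sum.Plus) (use fin in \<open>auto simp: w_def y_def scaleR_sum_right mult.commute case_prod_unfold\<close>)
        also have "\<dots> = (\<Sum>s\<in>L. u s *\<^sub>R s) + (\<Sum>t\<in>U. u t *\<^sub>R t)"
          by (simp add: scaleR_diff_left)
        also have "\<dots> = x" using u(3) splitv by simp
        finally have "(\<Sum>i\<in>?I. w i *\<^sub>R y i) = x" .
        moreover have "(\<Sum>i\<in>?I. w i *\<^sub>R y i) \<in> convex hull X"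
          by (rule convex_sum[OF finI convex_convex_hull w1 w0 yX])
        ultimately show ?thesis by simp
      qed
    qed
  qed
  then show ?thesis using finX by (auto simp: polytope_def)
qed

text \<open>  The coordinates in a pivot basis are entries, so the unit ball lies in the convex hull of \<open>0\<close> and
  the vectors \<open>\<plusminus>n x\<^sub>b\<close>. It is cut out of this polytope by the finitely many halfspaces
  \<open>\<plusminus>z\<^sub>l \<le> 1\<close>.\<close>

lemma polyhedral_subspace_linf_d:
  assumes E: "subspace_of_dim n E" "E \<subseteq> linf_d D"
  shows "polyhedral E norm"
proof -
  obtain x i where piv: "pivot_basis n E x i" using pivot_basis_exists[OF E(1)] by blast
  have subE: "subspace E" using E by (simp add: subspace_of_dim_def)
  have xE: "x b \<in> E" if "b < n" for b using piv that by (auto simp: pivot_basis_def)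
  have expand: "z = (\<Sum>b<n. apply_bcontfun z (i b) *\<^sub>R x b)" if "z \<in> E" for z
    using piv that by (auto simp: pivot_basis_def)
  define S where "S = insert 0 ((\<lambda>b. real n *\<^sub>R x b) ` {..<n} \<union> (\<lambda>b. (- real n) *\<^sub>R x b) ` {..<n})"
  define K where "K = convex hull S"
  have "finite S" by (simp add: S_def)
  then have pK: "polytope K" by (auto simp: K_def polytope_def)
  have SK: "S \<subseteq> K" by (simp add: K_def hull_subset)
  have cK: "convex K" by (simp add: K_def)
  have "S \<subseteq> E" using xE subE by (auto simp: S_def intro: subspace_0 subspace_scale subspace_neg)
  then have KE: "K \<subseteq> E" unfolding K_def using subE by (simp add: hull_minimal subspace_imp_convex)
  have ballK: "z \<in> K" if z: "z \<in> E" "norm z \<le> 1" for z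
  proof (cases "n = 0")
    case True
    then show ?thesis using expand[OF z(1)] SK by (simp add: S_def)
  next
    case False
    have "(real n * apply_bcontfun z (i b)) *\<^sub>R x b \<in> K" if b: "b < n" for b
    proof -
      define t where "t = apply_bcontfun z (i b)"
      have t: "\<bar>t\<bar> \<le> 1" using norm_bounded[of z "i b"] z(2) by (simp add: t_def)
      have "(sgn t * real n) *\<^sub>R x b \<in> S" using b by (cases t "0 :: real" rule: linorder_cases) (auto simp: S_def)
      moreover have "0 \<in> S" by (simp add: S_def)
      ultimately have "\<bar>t\<bar> *\<^sub>R ((sgn t * real n) *\<^sub>R x b) + (1 - \<bar>t\<bar>) *\<^sub>R 0 \<in> K"
        using SK t by (intro convexD[OF cK]) auto
      then show ?thesis by (simp add: t_def[symmetric] abs_mult_sgn mult.assoc[symmetric] mult.commute)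
    qed
    then have "(\<Sum>b<n. (1 / real n) *\<^sub>R ((real n * apply_bcontfun z (i b)) *\<^sub>R x b)) \<in> K"
      using False by (intro convex_sum[OF _ cK]) auto
    then show ?thesis using False expand[OF z(1)] by simp
  qed
  have cut: "polytope (K \<inter> {z. \<forall>l<m. apply_bcontfun z l \<le> 1 \<and> - apply_bcontfun z l \<le> 1})" for m
  proof (induction m)
    case 0
    then show ?case using pK by simp
  next
    case (Suc m)
    have l1: "linear (\<lambda>z :: linf. apply_bcontfun z m)" by (rule linearI) auto
    have l2: "linear (\<lambda>z :: linf. - apply_bcontfun z m)" by (rule linearI) auto
    have eq: "K \<inter> {z. \<forall>l<Suc m. apply_bcontfun z l \<le> 1 \<and> - apply_bcontfun z l \<le> 1}
       = (K \<inter> {z. \<forall>l<m. apply_bcontfun z l \<le> 1 \<and> - apply_bcontfun z l \<le> 1})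
         \<inter> {z. apply_bcontfun z m \<le> 1} \<inter> {z. - apply_bcontfun z m \<le> 1}"
      by (auto simp: less_Suc_eq)
    show ?case unfolding eq by (rule polytope_Int_halfspace[OF polytope_Int_halfspace[OF Suc l1] l2])
  qed
  have "{z \<in> E. norm z \<le> 1} = K \<inter> {z. \<forall>l<D. apply_bcontfun z l \<le> 1 \<and> - apply_bcontfun z l \<le> 1}"
  proof (intro set_eqI iffI)
    fix z assume "z \<in> {z \<in> E. norm z \<le> 1}"
    then have z: "z \<in> E" "norm z \<le> 1" by auto
    have "\<bar>apply_bcontfun z l\<bar> \<le> 1" for l using norm_bounded[of z l] z(2) by simp
    then have "apply_bcontfun z l \<le> 1 \<and> - apply_bcontfun z l \<le> 1" for l by (meson abs_le_iff)
    then show "z \<in> K \<inter> {z. \<forall>l<D. apply_bcontfun z l \<le> 1 \<and> - apply_bcontfun z l \<le> 1}" using ballK[OF z] by simp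
  next
    fix z assume z: "z \<in> K \<inter> {z. \<forall>l<D. apply_bcontfun z l \<le> 1 \<and> - apply_bcontfun z l \<le> 1}"
    then have zE: "z \<in> E" using KE by blast
    have "norm (apply_bcontfun z l) \<le> 1" for l
    proof (cases "l < D")
      case True
      then show ?thesis using z by (auto simp: abs_le_iff)
    next
      case False
      then show ?thesis using zE E(2) by (auto simp: linf_d_def)
    qed
    then show "z \<in> {z \<in> E. norm z \<le> 1}" using zE norm_bound by blast
  qed
  then show ?thesis using cut[of D] by (simp add: polyhedral_def)
qed

section \<open>The maximal projection constant is attained\<close>

theorem theorem1p4:
  fixes n :: nat
  assumes "n \<ge> 1"
  shows "(\<exists>(F :: linf set) N. banach_of_dim n F N \<and> polyhedral F N
            \<and> proj_const F N = max_proj_const n)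
       \<and> (\<exists>D\<ge>1. \<forall>d\<ge>D. max_proj_const_in n d = max_proj_const_in n D)"
proof -
  define D where "D = support_bound n + n"
  have D: "1 \<le> D" "n \<le> D" using assms by (auto simp: D_def)
  obtain s g where sg: "unit_weights D s" "orthonormal_columns D n g"
    and max: "\<And>s' g'. unit_weights D s' \<Longrightarrow> orthonormal_columns D n g' \<Longrightarrow> frame_energy D n s' g' \<le> frame_energy D n s g"
    using frame_energy_attains_max[OF D] by blast
  define M where "M = frame_energy D n s g"
  have M0: "0 \<le> M" using sg(1) unfolding M_def frame_energy_def
    by (auto simp: unit_weights_def intro!: sum_nonneg mult_nonneg_nonneg)
  have bound: "energy_bound n M"
    using energy_bound_from_frames[OF D_def] max unfolding M_def by blast
  note upper = proj_const_le_energy_bound[OF M0 bound]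
  obtain F where F: "subspace_of_dim n F" "F \<subseteq> linf_d D"
    and FP: "\<And>T P. isometric_embedding F norm T \<Longrightarrow> projection_onto (T ` F) P \<Longrightarrow> M \<le> onorm P"
    using subspace_from_maximal_frame[OF sg max] unfolding M_def by blast
  have norm_on: "norm_on V norm" for V :: "linf set"
    by (auto simp: norm_on_def norm_triangle_ineq)
  have banach: "banach_of_dim n V norm" if "subspace_of_dim n V" for V :: "linf set"
    using that norm_on by (simp add: banach_of_dim_def)
  have "isometric_embedding F norm (SOME T. isometric_embedding F norm T)"
    using isometric_embedding_exists[OF banach[OF F(1)]] by (rule someI_ex)
  then have "ereal M \<le> proj_const F norm"
    unfolding proj_const_def embedded_proj_const_def
    by (intro INF_greatest) (use FP in auto)
  with upper[OF banach[OF F(1)]] have FM: "proj_const F norm = ereal M" by (rule antisym)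
  have "max_proj_const n = ereal M"
    unfolding max_proj_const_def
  proof (rule antisym)
    show "Sup {proj_const V N |(V :: linf set) N. banach_of_dim n V N} \<le> ereal M"
      by (rule Sup_least) (use upper in auto)
    show "ereal M \<le> Sup {proj_const V N |(V :: linf set) N. banach_of_dim n V N}"
      by (rule Sup_upper) (use FM banach[OF F(1)] in force)
  qed
  then have "banach_of_dim n F norm \<and> polyhedral F norm \<and> proj_const F norm = max_proj_const n"
    using banach[OF F(1)] polyhedral_subspace_linf_d[OF F] FM by simp
  moreover have "max_proj_const_in n d = ereal M" if d: "d \<ge> D" for d
    unfolding max_proj_const_in_def
  proof (rule antisym)
    show "Sup {proj_const E norm |E. subspace_of_dim n E \<and> E \<subseteq> linf_d d} \<le> ereal M"
      by (rule Sup_least) (use upper banach in auto)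
    have "F \<subseteq> linf_d d" using F(2) d by (force simp: linf_d_def)
    then show "ereal M \<le> Sup {proj_const E norm |E. subspace_of_dim n E \<and> E \<subseteq> linf_d d}"
      by (intro Sup_upper) (use FM F(1) in force)
  qed
  ultimately show ?thesis using D(1) by (metis order_refl)
qed

end
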